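(* Let $m:\mathbb{R}^+\to\mathbb{R}^+$ and $M(\rho)=m(\rho)\rho$. Let $F:\mathcal{P}_{2,+,ac}(\mathbb{R})\to\mathbb{R}$ be a functional and let $\widetilde F$ be the functional on Lorenz curves satisfying $(\widetilde F\circ\mathbf{L})[\rho]=F[\rho]$ for every $\rho\in\mathcal{P}_{2,+,ac}(\mathbb{R})$. Then the Lorenz dynamics in the variables $(f,t,\mathcal{L})$, $\mathcal{L}_t=\mathbf{L}[\rho_t]$, of the $W_{2,M}$ gradient flow $$\frac{\partial\rho_t}{\partial t}=\mathrm{grad}_{W_{2,M},\rho_t}F[\rho_t]$$ are equivalent to $$\frac{\partial\mathcal{L}_t}{\partial t}=\mathrm{grad}_{\mathfrak{L},W_{2,M},\mathcal{L}_t}\widetilde F[\mathcal{L}_t].$$ That is, for a smooth time-parameterized curve $\rho_t$ with associated curve of Lorenz curves $\mathcal{L}_t=\mathbf{L}[\rho_t]$, $\rho_t$ evolves by the first equation if and only if $\mathcal{L}_t$ evolves by the second.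
   Context: $\mathcal{P}_{+,ac}(\mathbb{R})$ is the set of positive probability densities on $\mathbb{R}$ (absolutely continuous w.r.t. Lebesgue measure); $\mathcal{P}_{2,+,ac}(\mathbb{R})$ is the subset with finite second moment. For a density $\rho$, $C[\rho](x)=\int_{-\infty}^x\rho(y)\,dy$ is its cdf and $G[\rho]$ its inverse cdf. The Lorenz curve of $\rho$ is the function $\mathbf{L}[\rho]:[0,1]\to\mathbb{R}$, $\mathbf{L}[\rho](f)=\int_{-\infty}^{G[\rho](f)}y\rho(y)\,dy$. $\mathfrak{L}(\mathbb{R})=\{\mathbf{L}[\rho]:\rho\in\mathcal{P}_{+,ac}(\mathbb{R})\}$; the density with Lorenz curve $\mathcal{L}$ is denoted $\mathbf{P}[\mathcal{L}]$. All spaces of densities and of Lorenz curves are viewed as formal infinite-dimensional Riemannian manifolds. For a functional $F$ on a space of functions over $\Omega$, the Fréchet derivative $\frac{\delta F}{\delta u}$ at $u_0$ (when it exists) is the function with $\frac{d}{dt}\big|_{t=0}F[u_t]=\int_\Omega\frac{\delta F}{\delta u}[u_0](x)\,\frac{\partial u_t}{\partial t}\big|_{t=0}(x)\,dx$ for all smooth curves $u_t$ through $u_0$ at $t=0$. The gradient for the nonlinear-mobility Wasserstein space $W_{2,M}$ is $\mathrm{grad}_{W_{2,M},\rho}F[\rho]=-\frac{\partial}{\partial x}\left(M(\rho)\,\frac{\partial}{\partial x}\frac{\delta F}{\delta\rho}\right)$. The tangent space for Lorenz curves is $\mathbb{T}=\{\eta:[0,1]\to\mathbb{R}:\eta(0)=0,\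 \eta'(0)=0,\ \eta'(1)=0\}$, equipped at $\mathcal{L}$ with the metric tensor $\langle\eta_1,\eta_2\rangle_{\mathfrak{L},W_{2,M},\mathcal{L}}=\int_0^1\left(m\left(\frac{1}{\mathcal{L}''(f)}\right)\right)^{-1}\eta_1'(f)\,\eta_2'(f)\,df$. The gradient $\mathrm{grad}_{\mathfrak{L},W_{2,M},\mathcal{L}}\widetilde F$ is the element of $\mathbb{T}$ such that $\frac{d}{dt}\big|_{t=0}\widetilde F[\mathcal{L}_t]=\big\langle\mathrm{grad}_{\mathfrak{L},W_{2,M},\mathcal{L}}\widetilde F,\ \frac{\partial\mathcal{L}_t}{\partial t}\big|_{t=0}\big\rangle_{\mathfrak{L},W_{2,M},\mathcal{L}}$ for all smooth curves $\mathcal{L}_t$ of Lorenz curves with $\mathcal{L}_0=\mathcal{L}$.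
   Formalization: Assumed in addition: m is continuous; the Lorenz curves form a smooth curve with velocity in T; the Lorenz gradient of F̃ at each L_t exists in T. Derivatives are tested only along smooth curves differing from the base point on a compact set (for Lorenz curves: slope fixed near 0 and 1). *)

theory Defs
  imports "HOL-Analysis.Analysis"
begin

section \<open>Smooth functions on open subsets of Euclidean spaces\<close>

primrec k_times_differentiable_on ::
    "nat \<Rightarrow> 'a::euclidean_space set \<Rightarrow> ('a \<Rightarrow> 'b::real_normed_vector) \<Rightarrow> bool" where
  "k_times_differentiable_on 0 U f \<longleftrightarrow> continuous_on U f"
| "k_times_differentiable_on (Suc k) U f \<longleftrightarrow>
     (\<forall>z\<in>U. f differentiable (at z)) \<and>
     (\<forall>v. k_times_differentiable_on k U (\<lambda>z. frechet_derivative f (at z) v))"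

definition smooth_on :: "'a::euclidean_space set \<Rightarrow> ('a \<Rightarrow> 'b::real_normed_vector) \<Rightarrow> bool" where
  "smooth_on U f \<longleftrightarrow> (\<forall>k. k_times_differentiable_on k U f)"

section \<open>Densities and Lorenz curves\<close>

definition pos_densities :: "(real \<Rightarrow> real) set" where
  "pos_densities = {\<rho>. (\<forall>x. 0 < \<rho> x) \<and> integrable lborel \<rho> \<and> (LINT x|lborel. \<rho> x) = 1}"

definition pos_densities2 :: "(real \<Rightarrow> real) set" where
  "pos_densities2 = {\<rho> \<in> pos_densities. integrable lborel (\<lambda>x. x\<^sup>2 * \<rho> x)}"

definition cdf_of :: "(real \<Rightarrow> real) \<Rightarrow> real \<Rightarrow> real" where
  "cdf_of \<rho> x = (LBINT y=-\<infinity>..ereal x. \<rho> y)"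

text \<open>The cdf of a positive density is a bijection from the real line onto the open unit interval;
  its inverse is extended to the end points by the values \<open>-\<infinity>\<close> and \<open>\<infinity>\<close>.\<close>

definition inverse_cdf :: "(real \<Rightarrow> real) \<Rightarrow> real \<Rightarrow> ereal" where
  "inverse_cdf \<rho> f =
     (if f \<le> 0 then -\<infinity> else if 1 \<le> f then \<infinity> else ereal (inv (cdf_of \<rho>) f))"

text \<open>Lorenz curves are functions on \<open>[0,1]\<close>. As total functions they are extended by the constants
  \<open>0\<close> to the left and the mean to the right, so that the function on \<open>[0,1]\<close> determines
  its extension.\<close>

definition lorenz :: "(real \<Rightarrow> real) \<Rightarrow> real \<Rightarrow> real" where
  "lorenz \<rho> f = (LBINT y=-\<infinity>..inverse_cdf \<rho> f. y * \<rho> y)"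

section \<open>Smooth curves of densities and of Lorenz curves\<close>

definition smooth_density_curve :: "real set \<Rightarrow> (real \<Rightarrow> real \<Rightarrow> real) \<Rightarrow> bool" where
  "smooth_density_curve I \<rho> \<longleftrightarrow>
     (\<forall>t\<in>I. \<rho> t \<in> pos_densities2) \<and> smooth_on (I \<times> UNIV) (\<lambda>(t, x). \<rho> t x)"

definition lorenz_tangent_space :: "(real \<Rightarrow> real) set" where
  "lorenz_tangent_space =
     {\<eta>. (\<forall>f\<in>{0..1}. \<eta> differentiable (at f within {0..1})) \<and> \<eta> 0 = 0 \<and>
         (\<eta> has_real_derivative 0) (at 0 within {0..1}) \<and>
         (\<eta> has_real_derivative 0) (at 1 within {0..1})}"

text \<open>Joint smoothness is required over the open unit interval only, because the slope of a Lorenz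
  curve is infinite at both end points. The velocity of the curve must be a tangent vector; this
  includes the existence of the time derivative at the end points.\<close>

definition smooth_lorenz_curve :: "real set \<Rightarrow> (real \<Rightarrow> real \<Rightarrow> real) \<Rightarrow> bool" where
  "smooth_lorenz_curve I L \<longleftrightarrow>
     (\<forall>t\<in>I. L t \<in> lorenz ` pos_densities2) \<and>
     smooth_on (I \<times> {0<..<1}) (\<lambda>(t, f). L t f) \<and>
     (\<forall>t\<in>I. \<exists>\<eta>\<in>lorenz_tangent_space.
        \<forall>f\<in>{0..1}. ((\<lambda>s. L s f) has_real_derivative \<eta> f) (at t))"

text \<open>The smooth curves through a given point along which functionals are differentiated. As usual
  for functional derivatives, they differ from that point on a compact set only, so that no
  boundary terms arise; along curves without such a restriction even the entropy fails to be
  differentiable. For Lorenz curves it is the slope (the inverse cdf) that is left unchanged near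
  \<open>0\<close> and \<open>1\<close>; the Lorenz curve itself may change near \<open>1\<close> by an additive constant, the change of
  the mean.\<close>

definition density_variation :: "(real \<Rightarrow> real) \<Rightarrow> (real \<Rightarrow> real \<Rightarrow> real) \<Rightarrow> bool" where
  "density_variation \<rho> u \<longleftrightarrow> u 0 = \<rho> \<and>
     (\<exists>\<epsilon>>0. smooth_density_curve {-\<epsilon><..<\<epsilon>} u \<and>
        (\<exists>R. \<forall>s\<in>{-\<epsilon><..<\<epsilon>}. \<forall>x. R < \<bar>x\<bar> \<longrightarrow> u s x = \<rho> x))"

definition lorenz_variation :: "(real \<Rightarrow> real) \<Rightarrow> (real \<Rightarrow> real \<Rightarrow> real) \<Rightarrow> bool" where
  "lorenz_variation L l \<longleftrightarrow> l 0 = L \<and>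
     (\<exists>\<epsilon>>0. smooth_lorenz_curve {-\<epsilon><..<\<epsilon>} l \<and>
        (\<exists>\<delta>>0. \<forall>s\<in>{-\<epsilon><..<\<epsilon>}. \<forall>f\<in>{0<..<1}.
           f < \<delta> \<or> 1 - \<delta> < f \<longrightarrow> deriv (l s) f = deriv L f))"

section \<open>The gradient for the nonlinear-mobility Wasserstein space\<close>

definition has_Frechet_derivative ::
    "((real \<Rightarrow> real) \<Rightarrow> real) \<Rightarrow> (real \<Rightarrow> real) \<Rightarrow> (real \<Rightarrow> real) \<Rightarrow> bool" where
  "has_Frechet_derivative F \<rho> \<phi> \<longleftrightarrow>
     (\<forall>u. density_variation \<rho> u \<longrightarrow>
        integrable lborel (\<lambda>x. \<phi> x * deriv (\<lambda>s. u s x) 0) \<and>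
        ((\<lambda>s. F (u s)) has_real_derivative
           (LINT x|lborel. \<phi> x * deriv (\<lambda>s. u s x) 0)) (at 0))"

text \<open>Since mass is conserved, \<^term>\<open>has_Frechet_derivative F \<rho> \<phi>\<close> determines \<open>\<phi>\<close> up to an additive
  constant, which does not affect the gradient
  \<open>\<gamma> = - \<partial>/\<partial>x (M(\<rho>) \<partial>\<phi>/\<partial>x)\<close>.\<close>

definition has_W_gradient ::
    "(real \<Rightarrow> real) \<Rightarrow> ((real \<Rightarrow> real) \<Rightarrow> real) \<Rightarrow> (real \<Rightarrow> real) \<Rightarrow> (real \<Rightarrow> real) \<Rightarrow> bool" where
  "has_W_gradient M F \<rho> \<gamma> \<longleftrightarrow>
     (\<exists>\<phi>. has_Frechet_derivative F \<rho> \<phi> \<and> (\<forall>x. \<phi> differentiable (at x)) \<and>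
        (\<forall>x. ((\<lambda>y. M (\<rho> y) * deriv \<phi> y) has_real_derivative - \<gamma> x) (at x)))"

section \<open>The gradient on Lorenz curves\<close>

abbreviation lorenz_metric_density ::
    "(real \<Rightarrow> real) \<Rightarrow> (real \<Rightarrow> real) \<Rightarrow> (real \<Rightarrow> real) \<Rightarrow> (real \<Rightarrow> real) \<Rightarrow> real \<Rightarrow> real" where
  "lorenz_metric_density m L \<eta>1 \<eta>2 f \<equiv>
     inverse (m (1 / deriv (deriv L) f)) * deriv \<eta>1 f * deriv \<eta>2 f"

definition lorenz_metric ::
    "(real \<Rightarrow> real) \<Rightarrow> (real \<Rightarrow> real) \<Rightarrow> (real \<Rightarrow> real) \<Rightarrow> (real \<Rightarrow> real) \<Rightarrow> real" where
  "lorenz_metric m L \<eta>1 \<eta>2 = (LBINT f=0..1. lorenz_metric_density m L \<eta>1 \<eta>2 f)"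

definition has_lorenz_gradient ::
    "(real \<Rightarrow> real) \<Rightarrow> ((real \<Rightarrow> real) \<Rightarrow> real) \<Rightarrow> (real \<Rightarrow> real) \<Rightarrow> (real \<Rightarrow> real) \<Rightarrow> bool" where
  "has_lorenz_gradient m Ft L g \<longleftrightarrow> g \<in> lorenz_tangent_space \<and>
     (\<forall>l. lorenz_variation L l \<longrightarrow>
        interval_lebesgue_integrable lborel 0 1
          (lorenz_metric_density m L g (\<lambda>f. deriv (\<lambda>s. l s f) 0)) \<and>
        ((\<lambda>s. Ft (l s)) has_real_derivative
           lorenz_metric m L g (\<lambda>f. deriv (\<lambda>s. l s f) 0)) (at 0))"

section \<open>The gradient flows\<close>

definition W_gradient_flow ::
    "(real \<Rightarrow> real) \<Rightarrow> ((real \<Rightarrow> real) \<Rightarrow> real) \<Rightarrow> real set \<Rightarrow> (real \<Rightarrow> real \<Rightarrow> real) \<Rightarrow> bool" where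
  "W_gradient_flow M F I \<rho> \<longleftrightarrow>
     (\<forall>t\<in>I. \<exists>\<gamma>. has_W_gradient M F (\<rho> t) \<gamma> \<and>
        (\<forall>x. ((\<lambda>s. \<rho> s x) has_real_derivative \<gamma> x) (at t)))"

definition lorenz_gradient_flow ::
    "(real \<Rightarrow> real) \<Rightarrow> ((real \<Rightarrow> real) \<Rightarrow> real) \<Rightarrow> real set \<Rightarrow> (real \<Rightarrow> real \<Rightarrow> real) \<Rightarrow> bool" where
  "lorenz_gradient_flow m Ft I L \<longleftrightarrow>
     (\<forall>t\<in>I. \<exists>g. has_lorenz_gradient m Ft (L t) g \<and>
        (\<forall>f\<in>{0..1}. ((\<lambda>s. L s f) has_real_derivative g f) (at t)))"

end

theory Submission
  imports Defs
begin

text \<open>Let \<open>C\<close> be the cdf of \<open>\<rho>\<close>. A velocity \<open>\<eta>\<close> of Lorenz curves satisfies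
  \<open>\<rho>(x) \<eta>'(C(x)) = - c(x)\<close>, where \<open>c' = \<partial>\<^sub>t \<rho>\<close>. Substituting \<open>f = C(x)\<close>, the metric pairing of
  \<open>g\<close> with \<open>\<eta>\<close> becomes \<open>- \<integral> k c\<close> with \<open>k = g'(C) / m(\<rho>)\<close>, and for compactly supported variations an
  integration by parts makes this \<open>\<integral> \<phi> \<partial>\<^sub>t \<rho>\<close> with \<open>\<phi>' = k\<close>. So the Frechet derivative \<open>\<phi>\<close> of
  \<open>F\<close> and the Lorenz gradient \<open>g\<close> are related by \<open>\<rho> g'(C) = M(\<rho>) \<phi>'\<close>, and \<open>g\<close> is the velocity
  of the Lorenz curve iff \<open>- (M(\<rho>) \<phi>')'\<close> is the velocity of the density. The constant lost by
  differentiating is recovered from the boundedness of tangent vectors.\<close>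

section \<open>Calculus of smooth functions\<close>

text \<open>Variations are transported one way only: a density variation induces a Lorenz variation.
  A Lorenz gradient can thus be tested on densities, but no Lorenz gradient is constructed from a
  Frechet derivative; starting from the density flow, the gradient that is assumed to exist is
  identified with the velocity. The two directions also differ in regularity. If the Lorenz gradient
  is the velocity, its slope is continuous and the Frechet derivative is built by integration. In
  the other direction \<open>g\<close> is merely differentiable, \<open>deriv g\<close> need be
  neither continuous nor integrable, and it is compared with the density side almost everywhere,
  through test functions. The other obstacle is the tails. Joint smoothness of \<open>\<rho>\<close>
  gives no bound that would allow differentiation in time under an integral over a half-line. For
  the given curve the flux is therefore read off from the smooth Lorenz curves; for variations,
  fixed outside a compact set, every integral that changes with time reduces to one over a bounded
  interval.\<close>

abbreviation ck where "ck \<equiv> k_times_differentiable_on"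

text \<open>On an open set the derivative at a point depends only on values inside the set, so
  agreement passes to all directional derivatives.\<close>

lemma ck_cong:
  assumes "open U" "\<And>z. z \<in> U \<Longrightarrow> f z = g z" "ck k U f"
  shows "ck k U g"
  using assms(2,3)
proof (induction k arbitrary: f g)
  case 0
  then show ?case by (simp cong: continuous_on_cong)
next
  case (Suc k)
  have der: "(g has_derivative frechet_derivative f (at z)) (at z)" if "z \<in> U" for z
  proof (rule has_derivative_transform_within_open[OF _ \<open>open U\<close> that])
    show "(f has_derivative frechet_derivative f (at z)) (at z)"
      using Suc.prems that by (simp add: frechet_derivative_works[symmetric])
  qed (use Suc.prems in auto)
  have eq: "frechet_derivative g (at z) = frechet_derivative f (at z)" if "z \<in> U" for z
    using frechet_derivative_at[OF der[OF that]] by simp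
  have "ck k U (\<lambda>z. frechet_derivative g (at z) v)" for v
  proof (rule Suc.IH)
    show "frechet_derivative f (at z) v = frechet_derivative g (at z) v" if "z \<in> U" for z
      by (simp add: eq[OF that])
    show "ck k U (\<lambda>z. frechet_derivative f (at z) v)" using Suc.prems(2) by simp
  qed
  with der show ?case by (auto simp: differentiable_def)
qed

text \<open>Uniqueness of the derivative lets an explicit formula replace
  \<open>frechet_derivative\<close>. The closure properties below then follow from the
  differentiation rules, each formula being built from terms already known to be \<open>k\<close>
  times differentiable.\<close>

lemma ck_SucI:
  assumes U: "open U" and der: "\<And>z. z \<in> U \<Longrightarrow> (f has_derivative f' z) (at z)"
    and f': "\<And>v. ck k U (\<lambda>z. f' z v)"
  shows "ck (Suc k) U f"
proof -
  have "frechet_derivative f (at z) = f' z" if "z \<in> U" for z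
    using frechet_derivative_at[OF der[OF that]] by simp
  then have "ck k U (\<lambda>z. frechet_derivative f (at z) v)" for v
    by (intro ck_cong[OF U _ f']) auto
  with der show ?thesis by (auto simp: differentiable_def)
qed

lemma ck_SucD:
  assumes "ck (Suc k) U f"
  shows "z \<in> U \<Longrightarrow> (f has_derivative frechet_derivative f (at z)) (at z)"
    and "ck k U (\<lambda>z. frechet_derivative f (at z) v)"
  using assms by (auto simp: frechet_derivative_works[symmetric])

text \<open>The successor clause does not mention continuity of \<open>f\<close> itself, so lowering
  the order needs an argument: at order zero differentiability supplies it, and higher orders
  descend to the directional derivatives.\<close>

lemma ck_Suc_imp:
  assumes "ck (Suc k) U f"
  shows "ck k U f"
  using assms
proof (induction k arbitrary: f)
  case 0
  then show ?case
    by (auto intro!: continuous_at_imp_continuous_on differentiable_imp_continuous_within)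
next
  case (Suc k)
  have "ck (Suc k) U (\<lambda>z. frechet_derivative f (at z) v)" for v
    using Suc.prems by (rule ck_SucD)
  then have "\<forall>v. ck k U (\<lambda>z. frechet_derivative f (at z) v)" by (blast intro: Suc.IH)
  moreover have "\<forall>z\<in>U. f differentiable (at z)" using Suc.prems by simp
  ultimately show ?case by simp
qed

lemma ck_subset:
  assumes "ck k U f" "V \<subseteq> U"
  shows "ck k V f"
  using assms by (induction k arbitrary: f) (auto intro: continuous_on_subset)

lemma ck_const:
  assumes "open U"
  shows "ck k U (\<lambda>z. c)"
proof (induction k arbitrary: c)
  case (Suc k)
  show ?case by (rule ck_SucI[OF assms has_derivative_const]) (rule Suc)
qed simp

lemma ck_linear:
  assumes "open U" "bounded_linear h"
  shows "ck k U h"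
proof (cases k)
  case (Suc n)
  show ?thesis unfolding Suc
    by (rule ck_SucI[OF \<open>open U\<close>, where f' = "\<lambda>_. h"])
      (auto intro: bounded_linear_imp_has_derivative assms ck_const)
qed (use assms in \<open>simp add: linear_continuous_on\<close>)

lemma ck_linear_comp:
  assumes U: "open U" and h: "bounded_linear h" and f: "ck k U f"
  shows "ck k U (\<lambda>z. h (f z))"
  using f
proof (induction k arbitrary: f)
  case 0
  then show ?case using h by (auto intro: bounded_linear.continuous_on)
next
  case (Suc k)
  note D = ck_SucD[OF Suc.prems]
  show ?case
    by (rule ck_SucI[OF U bounded_linear.has_derivative[OF h D(1)] Suc.IH[OF D(2)]])
qed

lemma ck_add:
  assumes U: "open U" and "ck k U f" "ck k U g"
  shows "ck k U (\<lambda>z. f z + g z)"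
  using assms(2,3)
proof (induction k arbitrary: f g)
  case 0
  then show ?case by (auto intro: continuous_on_add)
next
  case (Suc k)
  note D = ck_SucD[OF Suc.prems(1)] ck_SucD[OF Suc.prems(2)]
  show ?case
    by (rule ck_SucI[OF U has_derivative_add[OF D(1) D(3)] Suc.IH[OF D(2) D(4)]])
qed

lemma ck_sum:
  assumes U: "open U" and "\<And>i. i \<in> A \<Longrightarrow> ck k U (f i)"
  shows "ck k U (\<lambda>z. \<Sum>i\<in>A. f i z)"
  using assms(2)
  by (induction A rule: infinite_finite_induct) (simp_all add: ck_const ck_add U)

lemma ck_scaleR:
  fixes g :: "'a::euclidean_space \<Rightarrow> 'b::real_normed_vector"
  assumes U: "open U" and "ck k U f" "ck k U g"
  shows "ck k U (\<lambda>z. f z *\<^sub>R g z)"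
  using assms(2,3)
proof (induction k arbitrary: f g)
  case 0
  then show ?case by (auto intro: continuous_on_scaleR)
next
  case (Suc k)
  note D = ck_SucD[OF Suc.prems(1)] ck_SucD[OF Suc.prems(2)]
  \<comment> \<open>The product rule pairs a derivative with an undifferentiated factor, so the
    factors are also needed at order \<open>k\<close>.\<close>
  note W = ck_Suc_imp[OF Suc.prems(1)] ck_Suc_imp[OF Suc.prems(2)]
  define h where "h z v = f z *\<^sub>R frechet_derivative g (at z) v + frechet_derivative f (at z) v *\<^sub>R g z" for z v
  show ?case
  proof (rule ck_SucI[OF U])
    show "((\<lambda>z. f z *\<^sub>R g z) has_derivative h z) (at z)" if "z \<in> U" for z
      using has_derivative_scaleR[OF D(1)[OF that] D(3)[OF that]] unfolding h_def[abs_def] .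
    show "ck k U (\<lambda>z. h z v)" for v
      unfolding h_def using ck_add[OF U Suc.IH[OF W(1) D(4)] Suc.IH[OF D(2) W(2)]] .
  qed
qed

lemma ck_mult:
  fixes f g :: "'a::euclidean_space \<Rightarrow> real"
  assumes "open U" "ck k U f" "ck k U g"
  shows "ck k U (\<lambda>z. f z * g z)"
  using ck_scaleR[OF assms] by simp

lemma ck_uminus:
  assumes "open U" "ck k U f"
  shows "ck k U (\<lambda>z. - f z)"
  by (rule ck_linear_comp[OF assms(1) _ assms(2)]) (rule bounded_linear_minus[OF bounded_linear_ident])

lemma ck_diff:
  assumes "open U" "ck k U f" "ck k U g"
  shows "ck k U (\<lambda>z. f z - g z)"
  using ck_add[OF assms(1,2) ck_uminus[OF assms(1,3)]] by simp

lemma ck_Pair: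
  assumes U: "open U" and "ck k U f" "ck k U g"
  shows "ck k U (\<lambda>z. (f z, g z))"
  using assms(2,3)
proof (induction k arbitrary: f g)
  case 0
  then show ?case by (simp add: continuous_on_Pair)
next
  case (Suc k)
  note D = ck_SucD[OF Suc.prems(1)] ck_SucD[OF Suc.prems(2)]
  show ?case
  proof (rule ck_SucI[OF U])
    show "((\<lambda>z. (f z, g z)) has_derivative
        (\<lambda>v. (frechet_derivative f (at z) v, frechet_derivative g (at z) v))) (at z)" if "z \<in> U" for z
      using has_derivative_Pair[OF D(1) D(3)] that by blast
    show "ck k U (\<lambda>z. (frechet_derivative f (at z) v, frechet_derivative g (at z) v))" for v
      using Suc.IH[OF D(2) D(4)] .
  qed
qed

text \<open>The chain rule evaluates the derivative of \<open>f\<close> in a direction that moves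
  with the point, whereas \<open>ck\<close> controls fixed directions only. Expanding that direction
  in the basis turns the derivative into a finite sum of products, each factor of which is covered
  by the induction.\<close>

lemma ck_compose:
  fixes h :: "'a::euclidean_space \<Rightarrow> 'b::euclidean_space"
    and f :: "'b \<Rightarrow> 'c::real_normed_vector"
  assumes U: "open U" and V: "open V" and hUV: "h ` U \<subseteq> V" and "ck k V f" "ck k U h"
  shows "ck k U (\<lambda>z. f (h z))"
  using assms(4,5)
proof (induction k arbitrary: f)
  case 0
  then show ?case using continuous_on_compose2[of V f U h] hUV by auto
next
  case (Suc k)
  note Df = ck_SucD[OF Suc.prems(1)] and Dh = ck_SucD[OF Suc.prems(2)]
  have hV: "h z \<in> V" if "z \<in> U" for z using hUV that by auto
  define f' where "f' z v = (\<Sum>b\<in>Basis. (frechet_derivative h (at z) v \<bullet> b) *\<^sub>R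
     frechet_derivative f (at (h z)) b)" for z v
  show ?case
  proof (rule ck_SucI[OF U])
    fix z assume z: "z \<in> U"
    have *: "frechet_derivative f (at (h z)) w = (\<Sum>b\<in>Basis. (w \<bullet> b) *\<^sub>R frechet_derivative f (at (h z)) b)" for w
    proof -
      have lin: "linear (frechet_derivative f (at (h z)))"
        using has_derivative_linear[OF Df(1)[OF hV[OF z]]] .
      have "frechet_derivative f (at (h z)) w = frechet_derivative f (at (h z)) (\<Sum>b\<in>Basis. (w \<bullet> b) *\<^sub>R b)"
        by (simp add: euclidean_representation)
      also have "\<dots> = (\<Sum>b\<in>Basis. (w \<bullet> b) *\<^sub>R frechet_derivative f (at (h z)) b)"
        by (simp add: linear_sum[OF lin] linear_scale[OF lin])
      finally show ?thesis .
    qed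
    have "((\<lambda>z. f (h z)) has_derivative (\<lambda>v. frechet_derivative f (at (h z)) (frechet_derivative h (at z) v))) (at z)"
      by (rule has_derivative_compose[OF Dh(1)[OF z] Df(1)[OF hV[OF z]]])
    moreover have "(\<lambda>v. frechet_derivative f (at (h z)) (frechet_derivative h (at z) v)) = f' z"
      by (rule ext) (simp only: f'_def *[symmetric])
    ultimately show "((\<lambda>z. f (h z)) has_derivative f' z) (at z)" by simp
  next
    fix v
    have "ck k U (\<lambda>z. frechet_derivative f (at (h z)) b)" for b
      by (rule Suc.IH[OF Df(2) ck_Suc_imp[OF Suc.prems(2)]])
    from ck_sum[OF U ck_scaleR[OF U ck_linear_comp[OF U bounded_linear_inner_left Dh(2)] this]]
    show "ck k U (\<lambda>z. f' z v)" unfolding f'_def .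
  qed
qed

lemma ck_inverse:
  fixes f :: "'a::euclidean_space \<Rightarrow> real"
  assumes U: "open U" and nz: "\<And>z. z \<in> U \<Longrightarrow> f z \<noteq> 0" and "ck k U f"
  shows "ck k U (\<lambda>z. inverse (f z))"
  using assms(3)
proof (induction k)
  case 0
  then show ?case using nz by (auto intro: continuous_on_inverse)
next
  case (Suc k)
  note D = ck_SucD[OF Suc.prems]
  have I: "ck k U (\<lambda>z. inverse (f z))" by (rule Suc.IH[OF ck_Suc_imp[OF Suc.prems]])
  show ?case
  proof (rule ck_SucI[OF U])
    show "((\<lambda>z. inverse (f z)) has_derivative
        (\<lambda>v. - (inverse (f z) * frechet_derivative f (at z) v * inverse (f z)))) (at z)" if "z \<in> U" for z
      by (rule Deriv.has_derivative_inverse[OF nz[OF that] D(1)[OF that]])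
    show "ck k U (\<lambda>z. - (inverse (f z) * frechet_derivative f (at z) v * inverse (f z)))" for v
      by (rule ck_uminus[OF U ck_mult[OF U ck_mult[OF U I D(2)] I]])
  qed
qed

section \<open>Partial derivatives of functions of two real variables\<close>

abbreviation partial1 :: "(real \<times> real \<Rightarrow> real) \<Rightarrow> real \<times> real \<Rightarrow> real" where
  "partial1 f z \<equiv> frechet_derivative f (at z) (1, 0)"

abbreviation partial2 :: "(real \<times> real \<Rightarrow> real) \<Rightarrow> real \<times> real \<Rightarrow> real" where
  "partial2 f z \<equiv> frechet_derivative f (at z) (0, 1)"

lemma smooth_on_partial:
  assumes "smooth_on U f"
  shows "smooth_on U (\<lambda>z. frechet_derivative f (at z) v)"
  using assms ck_SucD(2) unfolding smooth_on_def by blast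

lemma smooth_on_subset:
  assumes "smooth_on U f" "V \<subseteq> U"
  shows "smooth_on V f"
  using assms ck_subset unfolding smooth_on_def by blast

lemma smooth_on_cong:
  assumes "open U" "\<And>z. z \<in> U \<Longrightarrow> f z = g z" "smooth_on U f"
  shows "smooth_on U g"
  using assms ck_cong unfolding smooth_on_def by metis

lemma smooth_on_const_add:
  assumes "open U" "smooth_on U f"
  shows "smooth_on U (\<lambda>z. c + f z)"
  unfolding smooth_on_def
proof
  show "ck k U (\<lambda>z. c + f z)" for k
    using ck_add[OF assms(1) ck_const[OF assms(1)]] assms(2) unfolding smooth_on_def by blast
qed

lemma smooth_on_has_derivative:
  fixes f :: "real \<times> real \<Rightarrow> real"
  assumes "smooth_on U f" "z \<in> U"
  shows "(f has_derivative (\<lambda>v. partial1 f z * fst v + partial2 f z * snd v)) (at z)"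
proof -
  have der: "(f has_derivative frechet_derivative f (at z)) (at z)"
    using ck_SucD(1) assms unfolding smooth_on_def by blast
  have "frechet_derivative f (at z) v = partial1 f z * fst v + partial2 f z * snd v" for v
  proof -
    have lin: "linear (frechet_derivative f (at z))" using has_derivative_linear[OF der] .
    have "v = fst v *\<^sub>R (1, 0) + snd v *\<^sub>R (0, 1)" by (cases v) simp
    then have "frechet_derivative f (at z) v = frechet_derivative f (at z) (fst v *\<^sub>R (1, 0) + snd v *\<^sub>R (0, 1))"
      by simp
    also have "\<dots> = fst v *\<^sub>R partial1 f z + snd v *\<^sub>R partial2 f z"
      using linear_add[OF lin] linear_scale[OF lin] by metis
    finally show ?thesis by (simp add: mult.commute)
  qed
  then have "frechet_derivative f (at z) = (\<lambda>v. partial1 f z * fst v + partial2 f z * snd v)"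
    by (rule ext)
  with der show ?thesis by metis
qed

lemma has_derivative_along:
  fixes f :: "real \<times> real \<Rightarrow> real"
  assumes "(f has_derivative (\<lambda>v. p * fst v + q * snd v)) (at (a t, b t))"
    and "(a has_real_derivative a') (at t)" "(b has_real_derivative b') (at t)"
  shows "((\<lambda>s. f (a s, b s)) has_real_derivative p * a' + q * b') (at t)"
proof -
  have "((\<lambda>s. (a s, b s)) has_derivative (\<lambda>h. (a' * h, b' * h))) (at t)"
    using assms(2,3) unfolding has_field_derivative_def by (rule has_derivative_Pair)
  from has_derivative_compose[OF this assms(1)]
  show ?thesis unfolding has_field_derivative_def
    by (rule has_derivative_eq_rhs) (simp add: fun_eq_iff algebra_simps)
qed

lemma smooth_on_along:
  fixes f :: "real \<times> real \<Rightarrow> real"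
  assumes "smooth_on U f" "(a t, b t) \<in> U"
    and "(a has_real_derivative a') (at t)" "(b has_real_derivative b') (at t)"
  shows "((\<lambda>s. f (a s, b s)) has_real_derivative
           partial1 f (a t, b t) * a' + partial2 f (a t, b t) * b') (at t)"
  by (rule has_derivative_along[OF smooth_on_has_derivative[OF assms(1,2)] assms(3,4)])

lemma smooth_on_partial1:
  fixes f :: "real \<times> real \<Rightarrow> real"
  assumes "smooth_on U f" "(t, x) \<in> U"
  shows "((\<lambda>s. f (s, x)) has_real_derivative partial1 f (t, x)) (at t)"
  using smooth_on_along[of U f "\<lambda>s. s" t "\<lambda>_. x" 1 0] assms by auto

lemma smooth_on_partial2:
  fixes f :: "real \<times> real \<Rightarrow> real"
  assumes "smooth_on U f" "(t, x) \<in> U"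
  shows "((\<lambda>y. f (t, y)) has_real_derivative partial2 f (t, x)) (at x)"
  using smooth_on_along[of U f "\<lambda>_. t" x "\<lambda>y. y" 0 1] assms by auto

lemma smooth_on_DERIV_deriv:
  fixes f :: "real \<Rightarrow> real"
  assumes "smooth_on U f" "x \<in> U"
  shows "(f has_real_derivative deriv f x) (at x)"
  unfolding DERIV_deriv_iff_real_differentiable
proof (rule differentiableI)
  show "(f has_derivative frechet_derivative f (at x)) (at x)"
    using ck_SucD(1) assms unfolding smooth_on_def by blast
qed

lemma smooth_on_continuous:
  assumes "smooth_on U f"
  shows "continuous_on U f"
  using assms unfolding smooth_on_def using k_times_differentiable_on.simps(1) by blast

lemma smooth_on_isCont:
  assumes "smooth_on U f" "open U" "z \<in> U"
  shows "isCont f z"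
  using smooth_on_continuous[OF assms(1)] assms(2,3) continuous_on_eq_continuous_at by blast

text \<open>Schwarz's theorem: the second difference of \<open>f\<close> over a small square is
  \<open>h * h\<close> times either mixed derivative at some point of the square, by two mean value
  steps taken in either order. Were the mixed derivatives different at \<open>z\<close>, continuity
  would keep their values apart throughout the square.\<close>

lemma smooth_on_mixed_partials:
  fixes f :: "real \<times> real \<Rightarrow> real"
  assumes f: "smooth_on U f" and U: "open U" and z: "z \<in> U"
  shows "partial2 (partial1 f) z = partial1 (partial2 f) z"
proof (rule ccontr)
  assume ne: "partial2 (partial1 f) z \<noteq> partial1 (partial2 f) z"
  define A where "A = partial2 (partial1 f)"
  define B where "B = partial1 (partial2 f)"
  have A: "smooth_on U A" and B: "smooth_on U B" and f1: "smooth_on U (partial1 f)"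
    and f2: "smooth_on U (partial2 f)"
    unfolding A_def B_def by (intro smooth_on_partial f)+
  \<comment> \<open>Half the gap, so that the intervals of radius \<open>e\<close> around the two
    values are disjoint.\<close>
  define e where "e = \<bar>A z - B z\<bar> / 2"
  have e: "e > 0" using ne by (simp add: e_def A_def B_def)
  have "\<forall>\<^sub>F w in nhds z. w \<in> U \<and> dist (A w) (A z) < e \<and> dist (B w) (B z) < e"
  proof (intro eventually_conj)
    show "\<forall>\<^sub>F w in nhds z. w \<in> U" using U z by (simp add: eventually_nhds_in_open)
    show "\<forall>\<^sub>F w in nhds z. dist (A w) (A z) < e"
      using smooth_on_isCont[OF A U z] e
      by (auto intro: tendstoD simp: tendsto_at_iff_tendsto_nhds isCont_def)
    show "\<forall>\<^sub>F w in nhds z. dist (B w) (B z) < e"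
      using smooth_on_isCont[OF B U z] e
      by (auto intro: tendstoD simp: tendsto_at_iff_tendsto_nhds isCont_def)
  qed
  then obtain d where d: "d > 0"
    and near: "\<And>w. dist w z < d \<Longrightarrow> w \<in> U \<and> dist (A w) (A z) < e \<and> dist (B w) (B z) < e"
    unfolding eventually_nhds_metric by blast
  obtain t x where tx: "z = (t, x)" by (cases z)
  \<comment> \<open>A third, so that two sides of the square together stay below
    \<open>d\<close>.\<close>
  define h where "h = d / 3"
  have h: "h > 0" using d by (simp add: h_def)
  have box: "dist (s, y) z < d" if "t \<le> s" "s \<le> t + h" "x \<le> y" "y \<le> x + h" for s y
  proof -
    have "dist (s, y) z \<le> \<bar>s - t\<bar> + \<bar>y - x\<bar>"
      
      using sqrt_sum_squares_le_sum[of "\<bar>s - t\<bar>" "\<bar>y - x\<bar>"]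
      by (simp add: tx dist_Pair_Pair dist_real_def)
    also have "\<dots> \<le> h + h" using that by auto
    also have "\<dots> < d" using d by (simp add: h_def)
    finally show ?thesis .
  qed
  have inU: "(s, y) \<in> U" if "t \<le> s" "s \<le> t + h" "x \<le> y" "y \<le> x + h" for s y
    using near box that by blast
  define D where "D = f (t + h, x + h) - f (t + h, x) - f (t, x + h) + f (t, x)"
  have "\<exists>s>t. s < t + h \<and> (f (t + h, x + h) - f (t + h, x)) - (f (t, x + h) - f (t, x))
      = (t + h - t) * (partial1 f (s, x + h) - partial1 f (s, x))"
    by (rule MVT2) (use h in \<open>auto intro!: DERIV_diff smooth_on_partial1[OF f] inU\<close>)
  then obtain s where s: "t < s" "s < t + h" and Ds: "D = h * (partial1 f (s, x + h) - partial1 f (s, x))"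
    by (auto simp: D_def)
  have "\<exists>y>x. y < x + h \<and> partial1 f (s, x + h) - partial1 f (s, x) = (x + h - x) * A (s, y)"
    unfolding A_def by (rule MVT2) (use h s in \<open>auto intro!: smooth_on_partial2[OF f1] inU\<close>)
  then obtain y where y: "x < y" "y < x + h" and D1: "D = h * (h * A (s, y))"
    using Ds by auto
  have "\<exists>y>x. y < x + h \<and> (f (t + h, x + h) - f (t, x + h)) - (f (t + h, x) - f (t, x))
      = (x + h - x) * (partial2 f (t + h, y) - partial2 f (t, y))"
    by (rule MVT2[of x "x + h" "\<lambda>y. f (t + h, y) - f (t, y)"])
      (use h in \<open>auto intro!: DERIV_diff smooth_on_partial2[OF f] inU\<close>)
  then obtain y' where y': "x < y'" "y' < x + h"
    and Dy: "D = h * (partial2 f (t + h, y') - partial2 f (t, y'))"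
    by (auto simp: D_def)
  have "\<exists>s>t. s < t + h \<and> partial2 f (t + h, y') - partial2 f (t, y') = (t + h - t) * B (s, y')"
    unfolding B_def
    by (rule MVT2[of t "t + h" "\<lambda>s. partial2 f (s, y')"]) (use h y' in \<open>auto intro!: smooth_on_partial1[OF f2] inU\<close>)
  then obtain s' where s': "t < s'" "s' < t + h" and D2: "D = h * (h * B (s', y'))"
    using Dy by auto
  have "A (s, y) = B (s', y')" using D1 D2 h by simp
  moreover have "dist (A (s, y)) (A z) < e" using near box s y by auto
  moreover have "dist (B (s', y')) (B z) < e" using near box s' y' by auto
  ultimately show False unfolding e_def dist_real_def by (auto simp: abs_if split: if_splits)
qed

section \<open>Cumulative distribution functions and Lorenz curves\<close>

lemma LBINT_lower_eq:
  "(LBINT y=-\<infinity>..ereal x. h y) = (LINT y|lborel. indicator {..<x} y *\<^sub>R h y)"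
proof -
  have "einterval (-\<infinity>) (ereal x) = {..<x}" by (auto simp: einterval_iff)
  then show ?thesis by (simp add: interval_lebesgue_integral_def set_lebesgue_integral_def)
qed

lemma LBINT_full_eq: "(LBINT y=-\<infinity>..\<infinity>. h y) = (LINT y|lborel. h y)"
proof -
  have "einterval (-\<infinity>) \<infinity> = UNIV" by (auto simp: einterval_iff)
  then show ?thesis by (simp add: interval_lebesgue_integral_def set_lebesgue_integral_def)
qed

lemma interval_lebesgue_integrable_of_integrable:
  fixes h :: "real \<Rightarrow> real"
  assumes "integrable lborel h"
  shows "interval_lebesgue_integrable lborel a b h"
  unfolding interval_lebesgue_integrable_def set_integrable_def
  using integrable_mult_indicator[OF _ assms] by auto

lemma LBINT_split:
  fixes h :: "real \<Rightarrow> real"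
  assumes "integrable lborel h"
  shows "(LBINT y=a..c. h y) = (LBINT y=a..b. h y) + (LBINT y=b..c. h y)"
  by (rule interval_integral_sum[symmetric], rule interval_lebesgue_integrable_of_integrable[OF assms])

lemma has_derivative_LBINT_upper:
  fixes h :: "real \<Rightarrow> real"
  assumes "continuous_on UNIV h"
  shows "((\<lambda>x. LBINT y=ereal a..ereal x. h y) has_real_derivative h x) (at x)"
proof -
  define l r where "l = min a x - 1" and "r = max a x + 1"
  have "((\<lambda>u. LBINT y=ereal a..ereal u. h y) has_vector_derivative h x) (at x within {l..r})"
    by (rule interval_integral_FTC2)
      (auto simp: l_def r_def intro: continuous_on_subset[OF assms])
  moreover have "at x within {l..r} = at x"
    by (rule at_within_interior) (auto simp: l_def r_def)
  ultimately show ?thesis by (simp add: has_real_derivative_iff_has_vector_derivative)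
qed

lemma has_derivative_LBINT_lower:
  fixes h :: "real \<Rightarrow> real"
  assumes "integrable lborel h" "continuous_on UNIV h"
  shows "((\<lambda>x. LBINT y=-\<infinity>..ereal x. h y) has_real_derivative h x) (at x)"
proof -
  have "((\<lambda>x. (LBINT y=-\<infinity>..ereal 0. h y) + (LBINT y=ereal 0..ereal x. h y)) has_real_derivative 0 + h x) (at x)"
    by (intro DERIV_add DERIV_const has_derivative_LBINT_upper assms)
  then show ?thesis by (simp add: LBINT_split[OF assms(1), of "-\<infinity>" "ereal _" "ereal 0", symmetric])
qed

lemma tendsto_LBINT_lower_at_top:
  fixes h :: "real \<Rightarrow> real"
  assumes "integrable lborel h"
  shows "((\<lambda>x. LBINT y=-\<infinity>..ereal x. h y) \<longlongrightarrow> (LINT y|lborel. h y)) at_top"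
  unfolding LBINT_lower_eq
proof (rule integral_dominated_convergence_at_top[where w = "\<lambda>y. \<bar>h y\<bar>"])
  show "AE y in lborel. ((\<lambda>x. indicator {..<x} y *\<^sub>R h y) \<longlongrightarrow> h y) at_top"
  proof (rule AE_I2, rule tendsto_eventually)
    fix y :: real
    show "\<forall>\<^sub>F x in at_top. indicator {..<x} y *\<^sub>R h y = h y"
      using eventually_gt_at_top[of y] by eventually_elim auto
  qed
qed (use assms in \<open>auto simp: indicator_def\<close>)

lemma tendsto_LBINT_lower_at_bot:
  fixes h :: "real \<Rightarrow> real"
  assumes "integrable lborel h"
  shows "((\<lambda>x. LBINT y=-\<infinity>..ereal x. h y) \<longlongrightarrow> 0) at_bot"
  unfolding LBINT_lower_eq filterlim_at_bot_mirror
proof -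
  have "((\<lambda>x. LINT y|lborel. indicator {..<- x} y *\<^sub>R h y) \<longlongrightarrow> (LINT (y::real)|lborel. (0::real))) at_top"
  proof (rule integral_dominated_convergence_at_top[where w = "\<lambda>y. \<bar>h y\<bar>" ])
    show "AE y in lborel. ((\<lambda>x. indicator {..<- x} y *\<^sub>R h y) \<longlongrightarrow> 0) at_top"
    proof (rule AE_I2, rule tendsto_eventually)
      fix y :: real
      show "\<forall>\<^sub>F x in at_top. indicator {..<- x} y *\<^sub>R h y = 0"
        using eventually_gt_at_top[of "- y"] by eventually_elim auto
    qed
  qed (use assms in \<open>auto simp: indicator_def\<close>)
  then show "((\<lambda>x. LINT y|lborel. indicator {..<- x} y *\<^sub>R h y) \<longlongrightarrow> 0) at_top" by simp
qed

text \<open>Members of \<open>pos_densities2\<close> may be discontinuous. With continuity the cdf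
  has the density as its derivative at every point, hence is a differentiable bijection onto the
  open unit interval with differentiable inverse. The members of a smooth curve are of this
  kind.\<close>

locale continuous_density =
  fixes \<sigma> :: "real \<Rightarrow> real"
  assumes density: "\<sigma> \<in> pos_densities2"
    and cont: "continuous_on UNIV \<sigma>"
begin

lemma pos: "0 < \<sigma> x"
  and integrable: "integrable lborel \<sigma>"
  and total: "(LINT x|lborel. \<sigma> x) = 1"
  and second_moment: "integrable lborel (\<lambda>x. x\<^sup>2 * \<sigma> x)"
  using density by (auto simp: pos_densities2_def pos_densities_def)

lemma first_moment: "integrable lborel (\<lambda>x. x * \<sigma> x)"
proof (rule Bochner_Integration.integrable_bound)
  show "integrable lborel (\<lambda>x. \<sigma> x + x\<^sup>2 * \<sigma> x)"
    using integrable second_moment by auto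
  show "(\<lambda>x. x * \<sigma> x) \<in> borel_measurable lborel" using integrable by auto
  show "AE x in lborel. norm (x * \<sigma> x) \<le> norm (\<sigma> x + x\<^sup>2 * \<sigma> x)"
  proof (rule AE_I2)
    fix x :: real
    have "0 \<le> (\<bar>x\<bar> - 1)\<^sup>2 + 1 + x\<^sup>2" by simp
    then have "\<bar>x\<bar> \<le> 1 + x\<^sup>2" by (simp add: power2_diff)
    then have "\<bar>x\<bar> * \<sigma> x \<le> (1 + x\<^sup>2) * \<sigma> x" using pos[of x] by (intro mult_right_mono) auto
    moreover have "\<sigma> x + x\<^sup>2 * \<sigma> x \<ge> 0" using pos[of x] by auto
    ultimately show "norm (x * \<sigma> x) \<le> norm (\<sigma> x + x\<^sup>2 * \<sigma> x)"
      using pos[of x] by (simp add: abs_mult algebra_simps)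
  qed
qed

lemma DERIV_cdf: "(cdf_of \<sigma> has_real_derivative \<sigma> x) (at x)"
  unfolding cdf_of_def[abs_def] by (rule has_derivative_LBINT_lower[OF integrable cont])

lemma isCont_cdf: "isCont (cdf_of \<sigma>) x"
  using DERIV_cdf by (rule DERIV_isCont)

lemma cdf_strict_mono: "x < y \<Longrightarrow> cdf_of \<sigma> x < cdf_of \<sigma> y"
  by (rule DERIV_pos_imp_increasing) (use DERIV_cdf pos in blast)+

lemma cdf_less_iff: "cdf_of \<sigma> x < cdf_of \<sigma> y \<longleftrightarrow> x < y"
  using cdf_strict_mono by (metis less_asym' linorder_neqE)

lemma inj_cdf: "inj (cdf_of \<sigma>)"
  using cdf_less_iff by (metis injI less_irrefl linorder_neqE)

lemma cdf_at_top: "(cdf_of \<sigma> \<longlongrightarrow> 1) at_top"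
  using tendsto_LBINT_lower_at_top[OF integrable] total by (simp add: cdf_of_def[abs_def])

lemma cdf_at_bot: "(cdf_of \<sigma> \<longlongrightarrow> 0) at_bot"
  using tendsto_LBINT_lower_at_bot[OF integrable] by (simp add: cdf_of_def[abs_def])

lemma cdf_gt_0: "0 < cdf_of \<sigma> x"
proof -
  \<comment> \<open>The limit yields only a weak inequality; stepping back by one and using strict
    monotonicity makes it strict.\<close>
  have "0 \<le> cdf_of \<sigma> (x - 1)"
  proof (rule tendsto_upperbound[OF cdf_at_bot])
    show "\<forall>\<^sub>F z in at_bot. cdf_of \<sigma> z \<le> cdf_of \<sigma> (x - 1)"
      using eventually_le_at_bot[of "x - 2"] by eventually_elim (auto intro!: less_imp_le cdf_strict_mono)
  qed simp
  also have "\<dots> < cdf_of \<sigma> x" by (rule cdf_strict_mono) simp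
  finally show ?thesis .
qed

lemma cdf_less_1: "cdf_of \<sigma> x < 1"
proof -
  have "cdf_of \<sigma> x < cdf_of \<sigma> (x + 1)" by (rule cdf_strict_mono) simp
  also have "\<dots> \<le> 1"
  proof (rule tendsto_lowerbound[OF cdf_at_top])
    show "\<forall>\<^sub>F z in at_top. cdf_of \<sigma> (x + 1) \<le> cdf_of \<sigma> z"
      using eventually_ge_at_top[of "x + 2"] by eventually_elim (auto intro!: less_imp_le cdf_strict_mono)
  qed simp
  finally show ?thesis .
qed

lemma cdf_in: "cdf_of \<sigma> x \<in> {0<..<1}"
  using cdf_gt_0 cdf_less_1 by simp

lemma cdf_surj:
  assumes "f \<in> {0<..<1}"
  obtains x where "cdf_of \<sigma> x = f"
proof -
  have "\<forall>\<^sub>F x in at_bot. cdf_of \<sigma> x < f" using cdf_at_bot assms by (auto intro: order_tendstoD)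
  then obtain a where a: "cdf_of \<sigma> a < f" by (auto simp: eventually_at_bot_linorder)
  have "\<forall>\<^sub>F x in at_top. f < cdf_of \<sigma> x" using cdf_at_top assms by (auto intro: order_tendstoD)
  then obtain b where b: "f < cdf_of \<sigma> b" by (auto simp: eventually_at_top_linorder)
  have "a \<le> b" using cdf_less_iff[of a b] a b by linarith
  then show thesis
    using IVT[of "cdf_of \<sigma>" a f b] a b isCont_cdf that by (metis less_imp_le)
qed

lemma range_cdf: "range (cdf_of \<sigma>) = {0<..<1}"
  using cdf_surj cdf_in by (metis (no_types, opaque_lifting) image_subset_iff rangeI subsetI subset_antisym)

abbreviation quantile :: "real \<Rightarrow> real" where
  "quantile \<equiv> inv (cdf_of \<sigma>)"

lemma quantile_cdf [simp]: "quantile (cdf_of \<sigma> x) = x"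
  using inj_cdf by simp

lemma cdf_quantile: "f \<in> {0<..<1} \<Longrightarrow> cdf_of \<sigma> (quantile f) = f"
  using range_cdf by (simp add: f_inv_into_f)

lemma DERIV_quantile:
  assumes "f \<in> {0<..<1}"
  shows "(quantile has_real_derivative 1 / \<sigma> (quantile f)) (at f)"
proof -
  have "(quantile has_real_derivative inverse (\<sigma> (quantile f))) (at (cdf_of \<sigma> (quantile f)))"
    unfolding has_field_derivative_def
  proof (rule has_derivative_inverse_strong[of UNIV "quantile f" "cdf_of \<sigma>" _ "(*) (\<sigma> (quantile f))"])
    show "(cdf_of \<sigma> has_derivative (*) (\<sigma> (quantile f))) (at (quantile f))"
      using DERIV_cdf unfolding has_field_derivative_def .
    show "(*) (\<sigma> (quantile f)) \<circ> (*) (inverse (\<sigma> (quantile f))) = id"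
      using pos[of "quantile f"] by (simp add: fun_eq_iff)
  qed (simp_all add: isCont_cdf continuous_at_imp_continuous_on)
  then show ?thesis using cdf_quantile[OF assms] by (simp add: inverse_eq_divide)
qed

lemma lorenz_eq:
  assumes "f \<in> {0<..<1}"
  shows "lorenz \<sigma> f = (LBINT y=-\<infinity>..ereal (quantile f). y * \<sigma> y)"
  using assms by (simp add: lorenz_def inverse_cdf_def)

lemma lorenz_0: "lorenz \<sigma> 0 = 0"
  by (simp add: lorenz_def inverse_cdf_def)

lemma lorenz_1: "lorenz \<sigma> 1 = (LBINT y=-\<infinity>..\<infinity>. y * \<sigma> y)"
  by (simp add: lorenz_def inverse_cdf_def)

text \<open>In the chain rule the density at the quantile cancels against the derivative of the
  quantile. The slope of a Lorenz curve is thus the inverse cdf, and the reciprocal of its second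
  derivative is the density at the quantile; this is how \<open>\<rho>\<close> reappears as the
  argument of \<open>m\<close> in the metric.\<close>

lemma DERIV_lorenz:
  assumes f: "f \<in> {0<..<1}"
  shows "(lorenz \<sigma> has_real_derivative quantile f) (at f)"
proof (rule has_field_derivative_transform_within_open[OF _ _ f])
  have "((\<lambda>x. LBINT y=-\<infinity>..ereal x. y * \<sigma> y) has_real_derivative quantile f * \<sigma> (quantile f)) (at (quantile f))"
    by (rule has_derivative_LBINT_lower[OF first_moment]) (intro continuous_intros cont)
  from DERIV_chain2[OF this DERIV_quantile[OF f]]
  show "((\<lambda>f. LBINT y=-\<infinity>..ereal (quantile f). y * \<sigma> y) has_real_derivative quantile f) (at f)"
    using pos[of "quantile f"] by simp
qed (auto simp: lorenz_eq)

lemma deriv_lorenz: "f \<in> {0<..<1} \<Longrightarrow> deriv (lorenz \<sigma>) f = quantile f"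
  using DERIV_lorenz by (rule DERIV_imp_deriv)

lemma deriv2_lorenz:
  assumes f: "f \<in> {0<..<1}"
  shows "deriv (deriv (lorenz \<sigma>)) f = 1 / \<sigma> (quantile f)"
proof (rule DERIV_imp_deriv, rule has_field_derivative_transform_within_open[OF _ _ f])
  show "(quantile has_real_derivative 1 / \<sigma> (quantile f)) (at f)" by (rule DERIV_quantile[OF f])
qed (auto simp: deriv_lorenz)

end

lemma smooth_density_curve_continuous_density:
  assumes "smooth_density_curve I \<rho>" "open I" "t \<in> I"
  shows "continuous_density (\<rho> t)"
proof
  show "\<rho> t \<in> pos_densities2" using assms by (simp add: smooth_density_curve_def)
  have "continuous_on (I \<times> UNIV) (\<lambda>(t, x). \<rho> t x)"
    using assms(1) smooth_on_continuous by (auto simp: smooth_density_curve_def)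
  then have "continuous_on UNIV (\<lambda>x. (\<lambda>(t, x). \<rho> t x) (t, x))"
    by (rule continuous_on_compose2) (use assms in \<open>auto intro!: continuous_intros\<close>)
  then show "continuous_on UNIV (\<rho> t)" by simp
qed

section \<open>Velocity of a smooth curve of Lorenz curves\<close>

text \<open>Differentiating \<open>L\<^sub>f\<^sub>f \<rho>(t, L\<^sub>f) = 1\<close> in time shows that the flux
  \<open>- \<rho> L\<^sub>f\<^sub>t\<close>, taken at the value of the cdf, is an antiderivative of \<open>\<rho>\<^sub>t\<close>. This identifies
  it with the time derivative of the cdf up to a constant, without differentiating the cdf in time.\<close>

lemma smooth_lorenz_velocity:
  assumes \<rho>: "smooth_density_curve I \<rho>" and I: "open I" and t: "t \<in> I"
    and L: "smooth_on (I \<times> {0<..<1}) (\<lambda>(t, f). lorenz (\<rho> t) f)"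
  obtains w v where
    "\<And>f. f \<in> {0<..<1} \<Longrightarrow> ((\<lambda>s. lorenz (\<rho> s) f) has_real_derivative w f) (at t)"
    "\<And>f. f \<in> {0<..<1} \<Longrightarrow> (w has_real_derivative v f) (at f)"
    "\<And>f. f \<in> {0<..<1} \<Longrightarrow> ((\<lambda>s. deriv (lorenz (\<rho> s)) f) has_real_derivative v f) (at t)"
    "continuous_on {0<..<1} v"
    "\<And>x. ((\<lambda>x. - \<rho> t x * v (cdf_of (\<rho> t) x)) has_real_derivative deriv (\<lambda>s. \<rho> s x) t) (at x)"
proof -
  define P where "P = (\<lambda>(t, f). lorenz (\<rho> t) f)"
  define R where "R = (\<lambda>(t, x). \<rho> t x)"
  \<comment> \<open>The inverse cdf as a function of time and level; obtained as a derivative of the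
    Lorenz curve, it inherits joint smoothness.\<close>
  define Q where "Q = partial2 P"
  let ?W = "I \<times> {0<..<1::real}"
  have W: "open ?W" using I by (auto intro: open_Times)
  have R: "smooth_on (I \<times> UNIV) R" using \<rho> by (simp add: R_def smooth_density_curve_def)
  have P: "smooth_on ?W P" using L by (simp add: P_def)
  have Q: "smooth_on ?W Q" unfolding Q_def by (rule smooth_on_partial[OF P])
  have dens: "continuous_density (\<rho> s)" if "s \<in> I" for s
    by (rule smooth_density_curve_continuous_density[OF \<rho> I that])
  have Q_eq: "Q (s, f) = inv (cdf_of (\<rho> s)) f" if "s \<in> I" "f \<in> {0<..<1}" for s f
  proof -
    interpret continuous_density "\<rho> s" by (rule dens[OF that(1)])
    have "(lorenz (\<rho> s) has_real_derivative Q (s, f)) (at f)"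
      using smooth_on_partial2[OF P, of s f] that by (simp add: P_def Q_def)
    then show ?thesis using DERIV_lorenz[OF that(2)] by (rule DERIV_unique)
  qed
  have Q2_eq: "partial2 Q (s, f) = 1 / R (s, Q (s, f))" if "s \<in> I" "f \<in> {0<..<1}" for s f
  proof -
    interpret continuous_density "\<rho> s" by (rule dens[OF that(1)])
    have "(quantile has_real_derivative partial2 Q (s, f)) (at f)"
      by (rule has_field_derivative_transform_within_open[OF smooth_on_partial2[OF Q], of _ _ "{0<..<1}"])
        (use that Q_eq in auto)
    then show ?thesis using DERIV_quantile[OF that(2)] DERIV_unique Q_eq that by (fastforce simp: R_def)
  qed
  define w where "w f = partial1 P (t, f)" for f
  define v where "v f = partial1 Q (t, f)" for f
  interpret continuous_density "\<rho> t" by (rule dens[OF t])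
  show thesis
  proof (rule that[of w v])
    fix f :: real assume f: "f \<in> {0<..<1}"
    then have tf: "(t, f) \<in> ?W" using t by simp
    show "((\<lambda>s. lorenz (\<rho> s) f) has_real_derivative w f) (at t)"
      using smooth_on_partial1[OF P tf] by (simp add: P_def w_def)
    \<comment> \<open>The slope of the velocity is the velocity of the slope.\<close>
    have "partial2 (partial1 P) (t, f) = v f"
      unfolding v_def Q_def by (rule smooth_on_mixed_partials[OF P W tf])
    then show "(w has_real_derivative v f) (at f)"
      using smooth_on_partial2[OF smooth_on_partial[OF P, of "(1, 0)"] tf] by (simp add: w_def[abs_def])
    show "((\<lambda>s. deriv (lorenz (\<rho> s)) f) has_real_derivative v f) (at t)"
    proof (rule has_field_derivative_transform_within_open[OF _ I t])
      show "((\<lambda>s. Q (s, f)) has_real_derivative v f) (at t)"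
        unfolding v_def by (rule smooth_on_partial1[OF Q tf])
      show "Q (s, f) = deriv (lorenz (\<rho> s)) f" if "s \<in> I" for s
        using continuous_density.deriv_lorenz[OF dens[OF that] f] Q_eq[OF that f] by simp
    qed
  next
    have "continuous_on {0<..<1} (\<lambda>f. partial1 Q (t, f))"
      by (rule continuous_on_compose2[OF smooth_on_continuous[OF smooth_on_partial[OF Q, of "(1, 0)"]]])
        (use t in \<open>auto intro!: continuous_intros\<close>)
    then show "continuous_on {0<..<1} v" by (simp add: v_def[abs_def])
  next
    fix x :: real
    define f where "f = cdf_of (\<rho> t) x"
    have f: "f \<in> {0<..<1}" unfolding f_def by (rule cdf_in)
    then have tf: "(t, f) \<in> ?W" using t by simp
    have tx: "(t, x) \<in> I \<times> UNIV" using t by simp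
    have Qx: "Q (t, f) = x" using Q_eq[OF t f] by (simp add: f_def)
    have Rx: "R (t, x) = \<rho> t x" by (simp add: R_def)
    \<comment> \<open>The density followed along the quantile of a fixed level \<open>f\<close>. Its
      reciprocal is \<open>partial2 Q\<close>, so its time derivative gives, after exchanging
      derivatives, the slope of \<open>v\<close>.\<close>
    have "((\<lambda>s. R (s, Q (s, f))) has_real_derivative partial1 R (t, x) * 1 + partial2 R (t, x) * v f) (at t)"
      using smooth_on_along[OF R, of "\<lambda>s. s" t "\<lambda>s. Q (s, f)" 1 "v f"] smooth_on_partial1[OF Q tf] t
      by (simp add: Qx v_def)
    then have "((\<lambda>s. inverse (R (s, Q (s, f)))) has_real_derivative
        - (partial1 R (t, x) + partial2 R (t, x) * v f) / (\<rho> t x)\<^sup>2) (at t)"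
      by (rule DERIV_cong[OF DERIV_inverse'])
        (use pos[of x] in \<open>auto simp: Qx Rx field_simps power2_eq_square\<close>)
    then have "((\<lambda>s. partial2 Q (s, f)) has_real_derivative
        - (partial1 R (t, x) + partial2 R (t, x) * v f) / (\<rho> t x)\<^sup>2) (at t)"
      by (rule has_field_derivative_transform_within_open[OF _ I t])
        (simp add: Q2_eq[OF _ f] inverse_eq_divide)
    moreover have "((\<lambda>s. partial2 Q (s, f)) has_real_derivative partial1 (partial2 Q) (t, f)) (at t)"
      by (rule smooth_on_partial1[OF smooth_on_partial[OF Q] tf])
    ultimately have "partial1 (partial2 Q) (t, f) = - (partial1 R (t, x) + partial2 R (t, x) * v f) / (\<rho> t x)\<^sup>2"
      by (rule DERIV_unique[THEN sym])
    then have "(v has_real_derivative - (partial1 R (t, x) + partial2 R (t, x) * v f) / (\<rho> t x)\<^sup>2) (at f)"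
      using smooth_on_partial2[OF smooth_on_partial[OF Q, of "(1, 0)"] tf]
        smooth_on_mixed_partials[OF Q W tf] by (simp add: v_def[abs_def])
    then have dv: "((\<lambda>x. v (cdf_of (\<rho> t) x)) has_real_derivative
        - (partial1 R (t, x) + partial2 R (t, x) * v f) / (\<rho> t x)\<^sup>2 * \<rho> t x) (at x)"
      unfolding f_def by (rule DERIV_chain2[OF _ DERIV_cdf])
    have dR: "(\<rho> t has_real_derivative partial2 R (t, x)) (at x)"
      using smooth_on_partial2[OF R tx] by (simp add: R_def)
    \<comment> \<open>The two terms with \<open>partial2 R\<close> cancel, which leaves the time
      derivative of the density alone.\<close>
    have "((\<lambda>x. - \<rho> t x * v (cdf_of (\<rho> t) x)) has_real_derivative partial1 R (t, x)) (at x)"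
      by (rule DERIV_cong[OF DERIV_mult[OF DERIV_minus[OF dR] dv]])
        (use pos[of x] in \<open>auto simp: f_def field_simps power2_eq_square\<close>)
    moreover have "deriv (\<lambda>s. \<rho> s x) t = partial1 R (t, x)"
      using DERIV_imp_deriv[OF smooth_on_partial1[OF R tx]] by (simp add: R_def)
    ultimately show "((\<lambda>x. - \<rho> t x * v (cdf_of (\<rho> t) x)) has_real_derivative deriv (\<lambda>s. \<rho> s x) t) (at x)"
      by simp
  qed
qed

lemma smooth_density_curve_deriv:
  assumes \<rho>: "smooth_density_curve I \<rho>" and I: "open I" and t: "t \<in> I"
  shows "((\<lambda>s. \<rho> s x) has_real_derivative deriv (\<lambda>s. \<rho> s x) t) (at t)"
    and "continuous_on UNIV (\<lambda>x. deriv (\<lambda>s. \<rho> s x) t)"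
proof -
  define R where "R = (\<lambda>(t, x). \<rho> t x)"
  have R: "smooth_on (I \<times> UNIV) R" using \<rho> by (simp add: R_def smooth_density_curve_def)
  have d: "((\<lambda>s. \<rho> s x) has_real_derivative partial1 R (t, x)) (at t)" for x
    using smooth_on_partial1[OF R, of t x] t by (simp add: R_def)
  have eq: "deriv (\<lambda>s. \<rho> s x) t = partial1 R (t, x)" for x
    by (rule DERIV_imp_deriv[OF d])
  show "((\<lambda>s. \<rho> s x) has_real_derivative deriv (\<lambda>s. \<rho> s x) t) (at t)" using d eq by simp
  show "continuous_on UNIV (\<lambda>x. deriv (\<lambda>s. \<rho> s x) t)"
    unfolding eq
    by (rule continuous_on_compose2[OF smooth_on_continuous[OF smooth_on_partial[OF R, of "(1, 0)"]]])
      (use t in \<open>auto intro!: continuous_intros\<close>)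
qed

section \<open>Lorenz curves of compactly supported variations\<close>

lemma smooth_on_section:
  fixes h :: "real \<times> real \<Rightarrow> real"
  assumes h: "smooth_on (J \<times> UNIV) h" and s: "s \<in> J"
  shows "continuous_on A (\<lambda>y. h (s, y))"
  by (rule continuous_on_compose2[OF smooth_on_continuous[OF h]])
    (use s in \<open>auto intro!: continuous_intros\<close>)

lemma LBINT_has_derivative_param:
  fixes h :: "real \<times> real \<Rightarrow> real"
  assumes h: "smooth_on (J \<times> UNIV) h" and J: "open J" and s: "s \<in> J"
  shows "((\<lambda>s. LBINT y=ereal a..ereal b. h (s, y)) has_real_derivative
           (LBINT y=ereal a..ereal b. partial1 h (s, y))) (at s)"
proof -
  note h1 = smooth_on_partial[OF h, of "(1, 0)"]
  have *: "((\<lambda>s. LBINT y=ereal a..ereal b. h (s, y)) has_real_derivative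
           (LBINT y=ereal a..ereal b. partial1 h (s, y))) (at s)" if "a \<le> b" for a b
  proof -
    \<comment> \<open>The Leibniz rule asks for a convex set of parameters, which \<open>J\<close>
      need not be.\<close>
    obtain e where e: "e > 0" "ball s e \<subseteq> J" using J s open_contains_ball by blast
    let ?U = "ball s e"
    have U: "s \<in> ?U" "convex ?U" "open ?U" using e by auto
    have eq: "integral {a..b} (\<lambda>y. k (x, y)) = (LBINT y=ereal a..ereal b. k (x, y))"
      if "smooth_on (J \<times> UNIV) k" "x \<in> J" for k :: "real \<times> real \<Rightarrow> real" and x
      by (rule interval_integral_eq_integral[symmetric, OF \<open>a \<le> b\<close> borel_integrable_atLeastAtMost'])
        (rule smooth_on_section[OF that])
    have "((\<lambda>s. integral (cbox a b) (\<lambda>y. h (s, y))) has_real_derivative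
        integral (cbox a b) (\<lambda>y. partial1 h (s, y))) (at s within ?U)"
    proof (rule leibniz_rule_field_derivative[OF _ _ _ U(1,2)])
      show "((\<lambda>x. h (x, t)) has_real_derivative partial1 h (x, t)) (at x within ?U)" if "x \<in> ?U" for x t
        by (rule has_field_derivative_at_within[OF smooth_on_partial1[OF h]]) (use that e in auto)
      show "(\<lambda>y. h (x, y)) integrable_on cbox a b" if "x \<in> ?U" for x
        by (rule integrable_continuous, rule smooth_on_section[OF h]) (use that e in auto)
      show "continuous_on (?U \<times> cbox a b) (\<lambda>(x, t). partial1 h (x, t))"
        using continuous_on_subset[OF smooth_on_continuous[OF h1]] e by (simp add: case_prod_beta' Sigma_mono)
    qed
    then have "((\<lambda>s. integral {a..b} (\<lambda>y. h (s, y))) has_real_derivative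
        integral {a..b} (\<lambda>y. partial1 h (s, y))) (at s)"
      by (simp add: at_within_open[OF U(1,3)])
    then have D: "((\<lambda>s. integral {a..b} (\<lambda>y. h (s, y))) has_real_derivative
        (LBINT y=ereal a..ereal b. partial1 h (s, y))) (at s)" by (simp only: eq[OF h1 s])
    show ?thesis by (rule has_field_derivative_transform_within_open[OF D J s eq[OF h]])
  qed
  show ?thesis
  proof (cases "a \<le> b")
    case False
    then have "((\<lambda>s. - (LBINT y=ereal b..ereal a. h (s, y))) has_real_derivative
           - (LBINT y=ereal b..ereal a. partial1 h (s, y))) (at s)"
      by (intro DERIV_minus *) simp
    then show ?thesis by (simp only: interval_integral_endpoints_reverse[of "ereal a" "ereal b"])
  qed (rule *)
qed

text \<open>Two partial derivatives give a total derivative once one of them is jointly continuous;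
  here that one is the integrand at the end point, \<open>h\<close> itself.\<close>

lemma LBINT_has_derivative:
  fixes h :: "real \<times> real \<Rightarrow> real"
  assumes h: "smooth_on (J \<times> UNIV) h" and J: "open J" and s: "s \<in> J"
  shows "((\<lambda>(s, x). LBINT y=ereal a..ereal x. h (s, y)) has_derivative
           (\<lambda>v. (LBINT y=ereal a..ereal x. partial1 h (s, y)) * fst v + h (s, x) * snd v)) (at (s, x))"
proof -
  have "((\<lambda>(s, x). LBINT y=ereal a..ereal x. h (s, y)) has_derivative
      (\<lambda>(p, q). (LBINT y=ereal a..ereal x. partial1 h (s, y)) * p + blinfun_mult_right (h (s, x)) q))
      (at (s, x) within J \<times> UNIV)"
  proof (rule has_derivative_partialsI)
    show "((\<lambda>s. LBINT y=ereal a..ereal x. h (s, y)) has_derivative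
        (*) (LBINT y=ereal a..ereal x. partial1 h (s, y))) (at s within J)"
      using has_field_derivative_at_within[OF LBINT_has_derivative_param[OF h J s]]
      unfolding has_field_derivative_def .
    show "((\<lambda>x. LBINT y=ereal a..ereal x. h (s, y)) has_derivative blinfun_mult_right (h (s, x)))
        (at x within UNIV)" if "s \<in> J" for s x
      using has_derivative_LBINT_upper[OF smooth_on_section[OF h that]]
      by (simp add: has_field_derivative_def blinfun_mult_right.rep_eq)
    have "continuous (at (s, x) within J \<times> UNIV) h"
      using smooth_on_continuous[OF h] s by (auto simp: continuous_on_eq_continuous_within)
    then show "continuous (at (s, x) within J \<times> UNIV) (\<lambda>(s, x). blinfun_mult_right (h (s, x)))"
      by (simp add: case_prod_beta' bounded_linear.continuous[OF bounded_linear_blinfun_mult_right])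
  qed auto
  moreover have "at (s, x) within J \<times> UNIV = at (s, x)"
    by (rule at_within_open) (use s J in \<open>auto intro: open_Times\<close>)
  ultimately show ?thesis by (simp add: case_prod_beta' blinfun_mult_right.rep_eq)
qed

text \<open>The derivative consists of an integral of the same kind, with \<open>partial1 h\<close>
  for \<open>h\<close>, and of \<open>h\<close> itself; hence the induction on the order for all
  smooth \<open>h\<close> at once.\<close>

lemma smooth_on_LBINT:
  fixes h :: "real \<times> real \<Rightarrow> real"
  assumes h: "smooth_on (J \<times> UNIV) h" and J: "open J"
  shows "smooth_on (J \<times> UNIV) (\<lambda>(s, x). LBINT y=ereal a..ereal x. h (s, y))"
  unfolding smooth_on_def
proof
  fix k
  have U: "open (J \<times> (UNIV :: real set))" using J by (auto intro: open_Times)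
  show "ck k (J \<times> UNIV) (\<lambda>(s, x). LBINT y=ereal a..ereal x. h (s, y))"
    using h
  proof (induction k arbitrary: h)
    case 0
    show ?case
      unfolding k_times_differentiable_on.simps
    proof (rule continuous_at_imp_continuous_on, safe)
      fix s x assume "s \<in> J"
      from LBINT_has_derivative[OF 0 J this]
      show "isCont (\<lambda>(s, x). LBINT y=ereal a..ereal x. h (s, y)) (s, x)"
        by (rule has_derivative_continuous)
    qed
  next
    case (Suc k)
    define D where "D z v = (\<lambda>(s, x). LBINT y=ereal a..ereal x. partial1 h (s, y)) z * fst v + h z * snd v"
      for z :: "real \<times> real" and v :: "real \<times> real"
    show ?case
    proof (rule ck_SucI[OF U])
      fix z assume "z \<in> J \<times> (UNIV :: real set)"
      then obtain s x where z: "z = (s, x)" "s \<in> J" by auto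
      show "((\<lambda>(s, x). LBINT y=ereal a..ereal x. h (s, y)) has_derivative D z) (at z)"
        using LBINT_has_derivative[OF Suc.prems J z(2), of a x] unfolding z(1) D_def[abs_def] by simp
    next
      fix v
      have "ck k (J \<times> UNIV) (\<lambda>(s, x). LBINT y=ereal a..ereal x. partial1 h (s, y))"
        by (rule Suc.IH[OF smooth_on_partial[OF Suc.prems]])
      moreover have "ck k (J \<times> UNIV) h" using Suc.prems by (simp add: smooth_on_def)
      ultimately show "ck k (J \<times> UNIV) (\<lambda>z. D z v)"
        unfolding D_def by (intro ck_add ck_mult ck_const U)
    qed
  qed
qed

text \<open>The derivatives of a function inverse to \<open>C\<close> in the second variable are expressed by the
  derivatives of \<open>C\<close> at the function itself, so that each order of differentiability gives the next.\<close>

lemma smooth_on_inverse: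
  fixes C G :: "real \<times> real \<Rightarrow> real"
  assumes C: "smooth_on (J \<times> UNIV) C" and J: "open J"
    and C2: "\<And>s x. s \<in> J \<Longrightarrow> partial2 C (s, x) \<noteq> 0"
    and GC: "\<And>s x. s \<in> J \<Longrightarrow> G (s, C (s, x)) = x"
    and surj: "\<And>s f. s \<in> J \<Longrightarrow> f \<in> A \<Longrightarrow> C (s, G (s, f)) = f" and A: "open A"
  shows "smooth_on (J \<times> A) G"
proof -
  have U: "open (J \<times> (UNIV :: real set))" and W: "open (J \<times> A)"
    using J A by (auto intro: open_Times)
  define p q where "p z = - partial1 C (fst z, G z) * inverse (partial2 C (fst z, G z))"
    and "q z = inverse (partial2 C (fst z, G z))" for z
  have der: "(G has_derivative (\<lambda>v. p z * fst v + q z * snd v)) (at z)" if "z \<in> J \<times> A" for z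
  proof -
    obtain s f where z: "z = (s, f)" "s \<in> J" "f \<in> A" using \<open>z \<in> J \<times> A\<close> by auto
    define x where "x = G z"
    have Cx: "C (s, x) = f" using surj z by (simp add: x_def)
    have sx: "(s, x) \<in> J \<times> UNIV" using z by simp
    \<comment> \<open>Keeping time as first component turns the inversion of \<open>C\<close> in
      \<open>x\<close> into that of a map of the plane. The inverse function theorem applied here
      asks for continuity of \<open>\<Phi>\<close> on an open set, so that continuity of
      \<open>G\<close> is a result.\<close>
    define \<Phi> where "\<Phi> w = (fst w, C w)" for w
    define \<Psi> where "\<Psi> w = (fst w, G w)" for w
    have dPhi: "(\<Phi> has_derivative (\<lambda>v. (fst v, partial1 C (s, x) * fst v + partial2 C (s, x) * snd v))) (at (s, x))"
      unfolding \<Phi>_def[abs_def]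
      by (intro has_derivative_Pair smooth_on_has_derivative[OF C sx] has_derivative_fst has_derivative_ident)
    have "(\<Psi> has_derivative (\<lambda>v. (fst v, p z * fst v + q z * snd v))) (at (\<Phi> (s, x)))"
    proof (rule has_derivative_inverse_strong[OF U sx _ _ dPhi])
      show "continuous_on (J \<times> UNIV) \<Phi>"
        unfolding \<Phi>_def[abs_def] by (intro continuous_intros smooth_on_continuous[OF C])
      show "\<Psi> (\<Phi> w) = w" if "w \<in> J \<times> UNIV" for w
        using that GC by (auto simp: \<Phi>_def \<Psi>_def)
      show "(\<lambda>v. (fst v, partial1 C (s, x) * fst v + partial2 C (s, x) * snd v)) \<circ>
          (\<lambda>v. (fst v, p z * fst v + q z * snd v)) = id"
        using C2[OF z(2), of x] by (auto simp: fun_eq_iff p_def q_def x_def z(1) field_simps)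
    qed
    moreover have "\<Phi> (s, x) = z" by (simp add: \<Phi>_def Cx z)
    ultimately have "((\<lambda>w. snd (\<Psi> w)) has_derivative (\<lambda>v. snd (fst v, p z * fst v + q z * snd v))) (at z)"
      by (intro has_derivative_snd) simp
    then show ?thesis by (simp add: \<Psi>_def)
  qed
  have "ck k (J \<times> A) G" for k
  proof (induction k)
    case 0
    have "continuous_on (J \<times> A) G"
      using has_derivative_continuous[OF der] by (blast intro: continuous_at_imp_continuous_on)
    then show ?case by simp
  next
    case (Suc k)
    have comp: "ck k (J \<times> A) (\<lambda>z. h (fst z, G z))" if "smooth_on (J \<times> UNIV) h" for h :: "real \<times> real \<Rightarrow> real"
    proof (rule ck_compose[OF W U])
      show "ck k (J \<times> UNIV) h" using that by (simp add: smooth_on_def)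
      show "ck k (J \<times> A) (\<lambda>z. (fst z, G z))"
        by (rule ck_Pair[OF W ck_linear[OF W bounded_linear_fst] Suc])
    qed auto
    have q: "ck k (J \<times> A) q"
      unfolding q_def[abs_def]
      by (rule ck_inverse[OF W _ comp[OF smooth_on_partial[OF C]]]) (use C2 in auto)
    have p: "ck k (J \<times> A) p"
      unfolding p_def[abs_def]
      by (rule ck_mult[OF W ck_uminus[OF W comp[OF smooth_on_partial[OF C]]] q[unfolded q_def[abs_def]]])
    show ?case
      by (rule ck_SucI[OF W der], assumption) (intro ck_add ck_mult ck_const W p q)
  qed
  then show ?thesis by (simp add: smooth_on_def)
qed

text \<open>Outside a bounded interval \<open>u s\<close> is frozen, so its cdf and its first moment
  up to \<open>x\<close> are constants plus integrals over bounded intervals, smooth in both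
  variables; inverting the cdf and composing gives the Lorenz curves. As the total mass is fixed
  too, quantiles of levels near \<open>0\<close> and \<open>1\<close> do not move.\<close>

theorem lorenz_variation_of_density_variation:
  assumes var: "density_variation \<rho> u"
  shows "lorenz_variation (lorenz \<rho>) (\<lambda>s. lorenz (u s))"
proof -
  from var obtain \<epsilon> R where u0: "u 0 = \<rho>" and eps: "\<epsilon> > 0"
    and u: "smooth_density_curve {-\<epsilon><..<\<epsilon>} u"
    and eq: "\<And>s x. s \<in> {-\<epsilon><..<\<epsilon>} \<Longrightarrow> R < \<bar>x\<bar> \<Longrightarrow> u s x = \<rho> x"
    unfolding density_variation_def by blast
  define J where "J = {-\<epsilon><..<\<epsilon>}"
  have J: "open J" "0 \<in> J" using eps by (auto simp: J_def)
  have u: "smooth_density_curve J u" and eq: "\<And>s x. s \<in> J \<Longrightarrow> R < \<bar>x\<bar> \<Longrightarrow> u s x = \<rho> x"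
    using u eq by (simp_all add: J_def)
  have W: "open (J \<times> {0<..<1::real})" and UU: "open (J \<times> (UNIV::real set))" using J by (auto intro: open_Times)
  \<comment> \<open>\<open>R\<close> may be negative; \<open>r\<close> is positive and larger, so
    nothing changes from \<open>-r\<close> downwards and from \<open>r\<close> upwards.\<close>
  define r where "r = \<bar>R\<bar> + 1"
  define U where "U = (\<lambda>(s, x). u s x)"
  have U: "smooth_on (J \<times> UNIV) U" using u by (simp add: U_def smooth_density_curve_def)
  have dens: "continuous_density (u s)" if "s \<in> J" for s
    by (rule smooth_density_curve_continuous_density[OF u J(1) that])
  interpret \<rho>: continuous_density \<rho> using dens[OF J(2)] by (simp add: u0)
  have lower: "(LBINT y=-\<infinity>..ereal x. k y * u s y) = (LBINT y=-\<infinity>..ereal x. k y * \<rho> y)"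
    if "s \<in> J" "x \<le> -r" for s x and k :: "real \<Rightarrow> real"
    by (rule interval_integral_cong) (use that eq in \<open>auto simp: einterval_iff r_def\<close>)
  have upper: "(LBINT y=ereal x..\<infinity>. k y * u s y) = (LBINT y=ereal x..\<infinity>. k y * \<rho> y)"
    if "s \<in> J" "r \<le> x" for s x and k :: "real \<Rightarrow> real"
    by (rule interval_integral_cong) (use that eq in \<open>auto simp: einterval_iff r_def\<close>)
  have smooth_mult: "smooth_on (J \<times> UNIV) (\<lambda>z. snd z * U z)"
    using ck_mult[OF UU ck_linear[OF UU bounded_linear_snd]] U by (simp add: smooth_on_def)

  \<comment> \<open>\<open>C\<close> and \<open>B\<close> are the cdf and the first moment of
    \<open>u s\<close> up to \<open>x\<close>, with the part to the left of \<open>-r\<close> taken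
    from \<open>\<rho>\<close>.\<close>
  define C where "C = (\<lambda>z. cdf_of \<rho> (-r) + (\<lambda>(s, x). LBINT y=ereal (-r)..ereal x. U (s, y)) z)"
  define B where "B = (\<lambda>z. (LBINT y=-\<infinity>..ereal (-r). y * \<rho> y)
      + (\<lambda>(s, x). LBINT y=ereal (-r)..ereal x. snd (s, y) * U (s, y)) z)"
  have C: "smooth_on (J \<times> UNIV) C"
    unfolding C_def by (rule smooth_on_const_add[OF UU smooth_on_LBINT[OF U J(1)]])
  have B: "smooth_on (J \<times> UNIV) B"
    unfolding B_def by (rule smooth_on_const_add[OF UU smooth_on_LBINT[OF smooth_mult J(1)]])
  have C_eq: "C (s, x) = cdf_of (u s) x" if s: "s \<in> J" for s x
  proof -
    interpret continuous_density "u s" by (rule dens[OF s])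
    show ?thesis
      using lower[OF s, of "-r" "\<lambda>_. 1"] LBINT_split[OF integrable, of "-\<infinity>" x "-r"]
      by (simp add: C_def U_def cdf_of_def)
  qed
  have B_eq: "B (s, x) = (LBINT y=-\<infinity>..ereal x. y * u s y)" if s: "s \<in> J" for s x
  proof -
    interpret continuous_density "u s" by (rule dens[OF s])
    show ?thesis
      using lower[OF s, of "-r" "\<lambda>y. y"] LBINT_split[OF first_moment, of "-\<infinity>" x "-r"]
      by (simp add: B_def U_def)
  qed
  define G where "G = (\<lambda>(s, f). inv (cdf_of (u s)) f)"
  have G: "smooth_on (J \<times> {0<..<1}) G"
  proof (rule smooth_on_inverse[OF C J(1)])
    fix s x assume s: "s \<in> J"
    interpret continuous_density "u s" by (rule dens[OF s])
    have "((\<lambda>x. C (s, x)) has_real_derivative u s x) (at x)"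
      using DERIV_cdf by (simp add: C_eq[OF s])
    moreover have "((\<lambda>x. C (s, x)) has_real_derivative partial2 C (s, x)) (at x)"
      using smooth_on_partial2[OF C] s by simp
    ultimately have "partial2 C (s, x) = u s x" by (rule DERIV_unique[THEN sym])
    then show "partial2 C (s, x) \<noteq> 0" using pos[of x] by simp
    show "G (s, C (s, x)) = x" by (simp add: C_eq[OF s] G_def)
  next
    fix s f :: real assume s: "s \<in> J" and f: "f \<in> {0<..<1}"
    interpret continuous_density "u s" by (rule dens[OF s])
    show "C (s, G (s, f)) = f" using cdf_quantile[OF f] by (simp add: C_eq[OF s] G_def)
  qed simp
  have L_eq: "B (s, G (s, f)) = lorenz (u s) f" if s: "s \<in> J" and f: "f \<in> {0<..<1}" for s f
    using continuous_density.lorenz_eq[OF dens[OF s] f] by (simp add: B_eq[OF s] G_def)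
  have L: "smooth_on (J \<times> {0<..<1}) (\<lambda>(s, f). lorenz (u s) f)"
  proof (rule smooth_on_cong[OF W])
    show "smooth_on (J \<times> {0<..<1}) (\<lambda>z. B (fst z, G z))"
      unfolding smooth_on_def
    proof
      fix k
      show "ck k (J \<times> {0<..<1}) (\<lambda>z. B (fst z, G z))"
      proof (rule ck_compose[OF W UU])
        show "ck k (J \<times> UNIV) B" using B by (simp add: smooth_on_def)
        show "ck k (J \<times> {0<..<1}) (\<lambda>z. (fst z, G z))"
          by (rule ck_Pair[OF W ck_linear[OF W bounded_linear_fst]])
            (use G in \<open>simp add: smooth_on_def\<close>)
      qed auto
    qed
    show "B (fst z, G z) = (case z of (s, f) \<Rightarrow> lorenz (u s) f)" if "z \<in> J \<times> {0<..<1}" for z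
      using that L_eq by auto
  qed

  \<comment> \<open>The smaller of the masses that \<open>\<rho>\<close> puts to the left of
    \<open>-r\<close> and to the right of \<open>r\<close>: levels within \<open>\<delta>\<close> of
    an end point have their quantile where nothing changes.\<close>
  define \<delta> where "\<delta> = min (cdf_of \<rho> (-r)) (1 - cdf_of \<rho> r)"
  have delta: "\<delta> > 0" using \<rho>.cdf_gt_0 \<rho>.cdf_less_1 by (simp add: \<delta>_def)
  have cdf_lower: "cdf_of (u s) x = cdf_of \<rho> x" if "s \<in> J" "x \<le> -r" for s x
    using lower[OF that, of "\<lambda>_. 1"] by (simp add: cdf_of_def)
  have cdf_upper: "cdf_of (u s) x = cdf_of \<rho> x" if s: "s \<in> J" and x: "r \<le> x" for s x
  proof -
    interpret continuous_density "u s" by (rule dens[OF s])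
    \<comment> \<open>Seen from the right, the cdf is the total mass minus the upper tail, and both
      are unchanged.\<close>
    have "(LBINT y=-\<infinity>..\<infinity>. u s y) = (LBINT y=-\<infinity>..\<infinity>. \<rho> y)"
      using total \<rho>.total by (simp add: LBINT_full_eq)
    then show ?thesis
      using upper[OF s x, of "\<lambda>_. 1"] LBINT_split[OF integrable, of "-\<infinity>" \<infinity> x]
        LBINT_split[OF \<rho>.integrable, of "-\<infinity>" \<infinity> x] by (simp add: cdf_of_def)
  qed
  have quantile_lower: "inv (cdf_of (u s)) f = \<rho>.quantile f \<and> \<rho>.quantile f < -r"
    if s: "s \<in> J" and f: "f \<in> {0<..<1}" "f < \<delta>" for s f
  proof -
    interpret continuous_density "u s" by (rule dens[OF s])
    have "\<rho>.quantile f < -r"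
      using \<rho>.cdf_less_iff[of "\<rho>.quantile f" "-r"] \<rho>.cdf_quantile[OF f(1)] f(2) by (simp add: \<delta>_def)
    moreover from this have "cdf_of (u s) (\<rho>.quantile f) = f"
      using cdf_lower[OF s, of "\<rho>.quantile f"] \<rho>.cdf_quantile[OF f(1)] by simp
    ultimately show ?thesis using quantile_cdf[of "\<rho>.quantile f"] by simp
  qed
  have quantile_upper: "inv (cdf_of (u s)) f = \<rho>.quantile f \<and> r < \<rho>.quantile f"
    if s: "s \<in> J" and f: "f \<in> {0<..<1}" "1 - \<delta> < f" for s f
  proof -
    interpret continuous_density "u s" by (rule dens[OF s])
    have "r < \<rho>.quantile f"
      using \<rho>.cdf_less_iff[of r "\<rho>.quantile f"] \<rho>.cdf_quantile[OF f(1)] f(2)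
      by (simp add: \<delta>_def min_def split: if_splits)
    moreover from this have "cdf_of (u s) (\<rho>.quantile f) = f"
      using cdf_upper[OF s, of "\<rho>.quantile f"] \<rho>.cdf_quantile[OF f(1)] by simp
    ultimately show ?thesis using quantile_cdf[of "\<rho>.quantile f"] by simp
  qed
  have L_lower: "lorenz (u s) f = lorenz \<rho> f" if s: "s \<in> J" and f: "0 \<le> f" "f < \<delta>" "f < 1" for s f
  proof (cases "f = 0")
    case True
    then show ?thesis using continuous_density.lorenz_0[OF dens[OF s]] \<rho>.lorenz_0 by simp
  next
    case False
    then have f': "f \<in> {0<..<1}" using f by simp
    show ?thesis
      using quantile_lower[OF s f' f(2)] lower[OF s, of "\<rho>.quantile f" "\<lambda>y. y"]
      by (simp add: continuous_density.lorenz_eq[OF dens[OF s] f'] \<rho>.lorenz_eq[OF f'])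
  qed
  have L_upper: "lorenz (u s) f = lorenz (u s) 1 - (lorenz \<rho> 1 - lorenz \<rho> f)"
    if s: "s \<in> J" and f: "1 - \<delta> < f" "0 < f" "f \<le> 1" for s f
  proof (cases "f = 1")
    case False
    then have f': "f \<in> {0<..<1}" using f by simp
    interpret continuous_density "u s" by (rule dens[OF s])
    show ?thesis
      using quantile_upper[OF s f' f(1)] upper[OF s, of "\<rho>.quantile f" "\<lambda>y. y"]
        LBINT_split[OF first_moment, of "-\<infinity>" \<infinity> "\<rho>.quantile f"]
        LBINT_split[OF \<rho>.first_moment, of "-\<infinity>" \<infinity> "\<rho>.quantile f"]
      by (simp add: lorenz_eq[OF f'] \<rho>.lorenz_eq[OF f'] lorenz_1 \<rho>.lorenz_1)
  qed simp
  \<comment> \<open>Splitting the mean at \<open>r\<close> shows that it is smooth in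
    \<open>s\<close>: the tail beyond \<open>r\<close> is constant.\<close>
  have L1: "lorenz (u s) 1 = B (s, r) + (LBINT y=ereal r..\<infinity>. y * \<rho> y)" if s: "s \<in> J" for s
  proof -
    interpret continuous_density "u s" by (rule dens[OF s])
    show ?thesis
      using upper[OF s, of r "\<lambda>y. y"] LBINT_split[OF first_moment, of "-\<infinity>" \<infinity> r]
      by (simp add: lorenz_1 B_eq[OF s])
  qed

  \<comment> \<open>The velocity is zero near \<open>0\<close>, and near \<open>1\<close> it is the
    constant \<open>partial1 B (t, r)\<close>, the rate of change of the mean. Its slope therefore
    vanishes at both ends, as a tangent vector requires.\<close>
  have vel: "\<exists>\<eta>\<in>lorenz_tangent_space. \<forall>f\<in>{0..1}. ((\<lambda>s. lorenz (u s) f) has_real_derivative \<eta> f) (at t)"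
    if t: "t \<in> J" for t
  proof -
    from smooth_lorenz_velocity[OF u J(1) t L] obtain w v where
      w: "\<And>f. f \<in> {0<..<1} \<Longrightarrow> ((\<lambda>s. lorenz (u s) f) has_real_derivative w f) (at t)"
      and v: "\<And>f. f \<in> {0<..<1} \<Longrightarrow> (w has_real_derivative v f) (at f)" by metis
    define \<eta> where "\<eta> f = deriv (\<lambda>s. lorenz (u s) f) t" for f
    have d1: "((\<lambda>s. lorenz (u s) 1) has_real_derivative partial1 B (t, r)) (at t)"
    proof (rule has_field_derivative_transform_within_open[OF _ J(1) t])
      show "((\<lambda>s. B (s, r) + (LBINT y=ereal r..\<infinity>. y * \<rho> y)) has_real_derivative partial1 B (t, r)) (at t)"
        using DERIV_add[OF smooth_on_partial1[OF B, of t r] DERIV_const] t by simp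
    qed (simp add: L1)
    have d_lower: "((\<lambda>s. lorenz (u s) f) has_real_derivative 0) (at t)" if "0 \<le> f" "f < \<delta>" "f < 1" for f
      by (rule has_field_derivative_transform_within_open[OF DERIV_const J(1) t]) (simp add: L_lower that)
    have d_upper: "((\<lambda>s. lorenz (u s) f) has_real_derivative partial1 B (t, r)) (at t)"
      if "1 - \<delta> < f" "0 < f" "f \<le> 1" for f
    proof (rule has_field_derivative_transform_within_open[OF _ J(1) t])
      show "((\<lambda>s. lorenz (u s) 1 - (lorenz \<rho> 1 - lorenz \<rho> f)) has_real_derivative partial1 B (t, r)) (at t)"
        using DERIV_diff[OF d1 DERIV_const] by simp
    qed (simp add: L_upper[OF _ that])
    have eta_lower: "\<eta> f = 0" if "0 \<le> f" "f < \<delta>" "f < 1" for f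
      unfolding \<eta>_def by (rule DERIV_imp_deriv[OF d_lower[OF that]])
    have eta_upper: "\<eta> f = partial1 B (t, r)" if "1 - \<delta> < f" "0 < f" "f \<le> 1" for f
      unfolding \<eta>_def by (rule DERIV_imp_deriv[OF d_upper[OF that]])
    have eta_w: "\<eta> f = w f" if "f \<in> {0<..<1}" for f
      unfolding \<eta>_def by (rule DERIV_imp_deriv[OF w[OF that]])
    define d where "d = min \<delta> 1"
    have d: "d > 0" "d \<le> \<delta>" "d \<le> 1" using delta by (auto simp: d_def)
    have at0: "(\<eta> has_real_derivative 0) (at 0 within {0..1})"
      by (rule has_field_derivative_transform_within[OF DERIV_const d(1)])
        (use d in \<open>auto simp: eta_lower dist_real_def\<close>)
    have at1: "(\<eta> has_real_derivative 0) (at 1 within {0..1})"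
      by (rule has_field_derivative_transform_within[OF DERIV_const d(1)])
        (use d in \<open>auto simp: eta_upper dist_real_def\<close>)
    have inner: "(\<eta> has_real_derivative v f) (at f)" if "f \<in> {0<..<1}" for f
      by (rule has_field_derivative_transform_within_open[OF v[OF that] _ that]) (auto simp: eta_w)
    have "\<eta> differentiable (at f within {0..1})" if "f \<in> {0..1}" for f
    proof -
      consider "f = 0" | "f = 1" | "f \<in> {0<..<1}" using \<open>f \<in> {0..1}\<close> by force
      then show ?thesis
      proof cases
        case 3
        show ?thesis
          using has_field_derivative_at_within[OF inner[OF 3]] real_differentiable_def by blast
      qed (use at0 at1 real_differentiable_def in blast)+
    qed
    then have "\<eta> \<in> lorenz_tangent_space"
      using at0 at1 eta_lower[of 0] delta by (simp add: lorenz_tangent_space_def)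
    moreover have "((\<lambda>s. lorenz (u s) f) has_real_derivative \<eta> f) (at t)" if "f \<in> {0..1}" for f
    proof -
      consider "f = 0" | "f = 1" | "f \<in> {0<..<1}" using \<open>f \<in> {0..1}\<close> by force
      then show ?thesis
      proof cases
        case 1
        then show ?thesis using d_lower[of 0] eta_lower[of 0] delta by simp
      next
        case 2
        then show ?thesis using d_upper[of 1] eta_upper[of 1] delta by simp
      next
        case 3
        then show ?thesis using w[OF 3] eta_w[OF 3] by simp
      qed
    qed
    ultimately show ?thesis by blast
  qed
  have "smooth_lorenz_curve J (\<lambda>s. lorenz (u s))"
    unfolding smooth_lorenz_curve_def
    using L vel continuous_density.density[OF dens] by blast
  moreover have "deriv (lorenz (u s)) f = deriv (lorenz \<rho>) f"
    if s: "s \<in> J" and f: "f \<in> {0<..<1}" "f < \<delta> \<or> 1 - \<delta> < f" for s f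
    using quantile_lower[OF s f(1)] quantile_upper[OF s f(1)] f(2)
    by (auto simp: continuous_density.deriv_lorenz[OF dens[OF s] f(1)] \<rho>.deriv_lorenz[OF f(1)])
  ultimately show ?thesis
    unfolding lorenz_variation_def using u0 eps delta J_def by blast
qed

section \<open>The first variations in both coordinates\<close>

lemma compactly_supported_integrable:
  fixes f :: "real \<Rightarrow> real"
  assumes f: "continuous_on UNIV f" and 0: "\<And>x. r < \<bar>x\<bar> \<Longrightarrow> f x = 0"
  shows "integrable lborel f"
proof -
  have "set_integrable lborel {-r..r} f"
    by (rule borel_integrable_atLeastAtMost') (rule continuous_on_subset[OF f], simp)
  moreover have "(\<lambda>x. indicator {-r..r} x *\<^sub>R f x) = f"
  proof
    show "indicator {-r..r} x *\<^sub>R f x = f x" for x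
      using 0[of x] by (cases "r < \<bar>x\<bar>") (auto simp: indicator_def abs_less_iff)
  qed
  ultimately show ?thesis by (simp add: set_integrable_def)
qed

lemma DERIV_compactly_supported:
  fixes c :: "real \<Rightarrow> real"
  assumes "(c has_real_derivative d) (at x)" "\<And>x. r < \<bar>x\<bar> \<Longrightarrow> c x = 0" "r < \<bar>x\<bar>"
  shows "d = 0"
proof (rule DERIV_unique[OF assms(1)])
  have "open {x. r < \<bar>x\<bar>}" by (intro open_Collect_less continuous_intros)
  then show "(c has_real_derivative 0) (at x)"
    by (rule has_field_derivative_transform_within_open[OF DERIV_const]) (use assms in auto)
qed

lemma integration_by_parts_compact_support:
  fixes \<phi> c :: "real \<Rightarrow> real"
  assumes phi: "\<And>x. (\<phi> has_real_derivative \<phi>' x) (at x)" "continuous_on UNIV \<phi>'"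
    and c: "\<And>x. (c has_real_derivative c' x) (at x)" "continuous_on UNIV c'"
    and supp: "\<And>x. r < \<bar>x\<bar> \<Longrightarrow> c x = 0"
  shows "integrable lborel (\<lambda>x. \<phi> x * c' x)"
    and "integrable lborel (\<lambda>x. \<phi>' x * c x)"
    and "(LINT x|lborel. \<phi> x * c' x) = - integral UNIV (\<lambda>x. \<phi>' x * c x)"
proof -
  have cont: "continuous_on UNIV \<phi>" "continuous_on UNIV c"
    using phi(1) c(1) by (auto intro!: continuous_at_imp_continuous_on DERIV_isCont)
  have supp': "c' x = 0" if "r < \<bar>x\<bar>" for x
    by (rule DERIV_compactly_supported[OF c(1) supp that])
  show i1: "integrable lborel (\<lambda>x. \<phi> x * c' x)"
    by (rule compactly_supported_integrable[of _ r]) (auto intro!: continuous_intros cont c(2) simp: supp')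
  show i2: "integrable lborel (\<lambda>x. \<phi>' x * c x)"
    by (rule compactly_supported_integrable[of _ r]) (auto intro!: continuous_intros cont phi(2) simp: supp)
  \<comment> \<open>A point beyond the support, where the boundary terms vanish; the absolute value
    because \<open>r\<close> may be negative.\<close>
  define q where "q = \<bar>r\<bar> + 1"
  have "((\<lambda>x. \<phi> x * c' x + \<phi>' x * c x) has_integral \<phi> q * c q - \<phi> (-q) * c (-q)) {-q..q}"
  proof (rule fundamental_theorem_of_calculus)
    fix x
    have "((\<lambda>x. \<phi> x * c x) has_real_derivative \<phi> x * c' x + \<phi>' x * c x) (at x)"
      by (rule DERIV_cong[OF DERIV_mult[OF phi(1) c(1)]]) simp
    then show "((\<lambda>x. \<phi> x * c x) has_vector_derivative \<phi> x * c' x + \<phi>' x * c x) (at x within {-q..q})"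
      by (simp add: has_real_derivative_iff_has_vector_derivative has_vector_derivative_at_within)
  qed (simp add: q_def)
  then have "((\<lambda>x. \<phi> x * c' x + \<phi>' x * c x) has_integral 0) {-q..q}"
    using supp[of q] supp[of "-q"] by (simp add: q_def)
  then have "((\<lambda>x. \<phi> x * c' x + \<phi>' x * c x) has_integral 0) UNIV"
    by (rule has_integral_on_superset) (auto simp: q_def supp supp')
  moreover have "((\<lambda>x. \<phi> x * c' x + \<phi>' x * c x) has_integral
      (LINT x|lborel. \<phi> x * c' x) + (LINT x|lborel. \<phi>' x * c x)) UNIV"
    by (intro has_integral_add has_integral_integral_lborel i1 i2)
  ultimately have "(LINT x|lborel. \<phi> x * c' x) + (LINT x|lborel. \<phi>' x * c x) = 0"
    by (rule has_integral_unique[THEN sym])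
  then show "(LINT x|lborel. \<phi> x * c' x) = - integral UNIV (\<lambda>x. \<phi>' x * c x)"
    using integral_lborel[OF i2] by simp
qed

text \<open>The substitution \<open>f = C(x)\<close> turns the metric pairing into a pairing with the flux.\<close>

lemma lorenz_metric_eq_flux_integral:
  assumes var: "density_variation \<rho> u"
  obtains c r where
    "\<And>x. (c has_real_derivative deriv (\<lambda>s. u s x) 0) (at x)"
    "\<And>x. r < \<bar>x\<bar> \<Longrightarrow> c x = 0"
    "continuous_on UNIV (\<lambda>x. deriv (\<lambda>s. u s x) 0)"
    "\<And>m g. interval_lebesgue_integrable lborel 0 1
        (lorenz_metric_density m (lorenz \<rho>) g (\<lambda>f. deriv (\<lambda>s. lorenz (u s) f) 0)) \<Longrightarrow>
      (\<lambda>x. deriv g (cdf_of \<rho> x) / m (\<rho> x) * c x) absolutely_integrable_on UNIV \<and>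
      lorenz_metric m (lorenz \<rho>) g (\<lambda>f. deriv (\<lambda>s. lorenz (u s) f) 0)
        = - integral UNIV (\<lambda>x. deriv g (cdf_of \<rho> x) / m (\<rho> x) * c x)"
proof -
  from lorenz_variation_of_density_variation[OF var] obtain \<epsilon> \<delta> where eps: "\<epsilon> > 0"
    and L: "smooth_lorenz_curve {-\<epsilon><..<\<epsilon>} (\<lambda>s. lorenz (u s))"
    and delta: "\<delta> > 0" "\<And>s f. s \<in> {-\<epsilon><..<\<epsilon>} \<Longrightarrow> f \<in> {0<..<1} \<Longrightarrow> f < \<delta> \<or> 1 - \<delta> < f \<Longrightarrow>
         deriv (lorenz (u s)) f = deriv (lorenz \<rho>) f"
    unfolding lorenz_variation_def by blast
  from var obtain \<epsilon>' where u0: "u 0 = \<rho>" and eps': "\<epsilon>' > 0"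
    and u: "smooth_density_curve {-\<epsilon>'<..<\<epsilon>'} u"
    unfolding density_variation_def by blast
  define J where "J = {-\<epsilon><..<\<epsilon>} \<inter> {-\<epsilon>'<..<\<epsilon>'}"
  have J: "open J" "0 \<in> J" using eps eps' by (auto simp: J_def)
  have sub: "J \<subseteq> {-\<epsilon><..<\<epsilon>}" "J \<subseteq> {-\<epsilon>'<..<\<epsilon>'}" by (auto simp: J_def)
  have "{-\<epsilon>'<..<\<epsilon>'} \<times> UNIV \<supseteq> J \<times> (UNIV :: real set)"
    and sub2: "{-\<epsilon><..<\<epsilon>} \<times> {0<..<1} \<supseteq> J \<times> {0<..<1::real}"
    using sub by auto
  then have "smooth_on (J \<times> UNIV) (\<lambda>(s, x). u s x)"
    using u by (auto simp: smooth_density_curve_def intro: smooth_on_subset)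
  then have u: "smooth_density_curve J u"
    using u sub(2) by (auto simp: smooth_density_curve_def)
  have L: "smooth_on (J \<times> {0<..<1}) (\<lambda>(s, f). lorenz (u s) f)"
    by (rule smooth_on_subset[OF _ sub2]) (use L in \<open>simp add: smooth_lorenz_curve_def\<close>)
  have "continuous_density (u 0)"
    by (rule smooth_density_curve_continuous_density[OF u J])
  then interpret continuous_density \<rho> unfolding u0 .
  obtain w v where
      w: "\<And>f. f \<in> {0<..<1} \<Longrightarrow> ((\<lambda>s. lorenz (u s) f) has_real_derivative w f) (at 0)"
      and v: "\<And>f. f \<in> {0<..<1} \<Longrightarrow> (w has_real_derivative v f) (at f)"
      and v_mixed: "\<And>f. f \<in> {0<..<1} \<Longrightarrow> ((\<lambda>s. deriv (lorenz (u s)) f) has_real_derivative v f) (at 0)"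
      and "continuous_on {0<..<1} v"
      and flux: "\<And>x. ((\<lambda>x. - u 0 x * v (cdf_of (u 0) x)) has_real_derivative deriv (\<lambda>s. u s x) 0) (at x)"
    using smooth_lorenz_velocity[OF u J L] by blast
  define c where "c x = - \<rho> x * v (cdf_of \<rho> x)" for x
  define \<eta> where "\<eta> f = deriv (\<lambda>s. lorenz (u s) f) 0" for f
  have eta: "deriv \<eta> f = v f" if "f \<in> {0<..<1}" for f
  proof (rule DERIV_imp_deriv, rule has_field_derivative_transform_within_open[OF v[OF that] _ that])
    show "w f = \<eta> f" if "f \<in> {0<..<1}" for f
      unfolding \<eta>_def using DERIV_imp_deriv[OF w[OF that]] by simp
  qed simp
  \<comment> \<open>Near the end points the slopes of the Lorenz curves do not move with
    \<open>s\<close>; this is what gives the flux \<open>c\<close> compact support.\<close>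
  have v0: "v f = 0" if f: "f \<in> {0<..<1}" "f < \<delta> \<or> 1 - \<delta> < f" for f
  proof (rule DERIV_unique[OF v_mixed[OF f(1)]])
    show "((\<lambda>s. deriv (lorenz (u s)) f) has_real_derivative 0) (at 0)"
      by (rule has_field_derivative_transform_within_open[OF DERIV_const J])
        (use delta(2) f in \<open>auto simp: J_def\<close>)
  qed
  have "\<forall>\<^sub>F x in at_bot. cdf_of \<rho> x < \<delta>" using cdf_at_bot delta by (auto intro: order_tendstoD)
  then obtain a where a: "\<And>x. x \<le> a \<Longrightarrow> cdf_of \<rho> x < \<delta>" by (auto simp: eventually_at_bot_linorder)
  have "\<forall>\<^sub>F x in at_top. 1 - \<delta> < cdf_of \<rho> x" using cdf_at_top delta by (auto intro: order_tendstoD)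
  then obtain b where b: "\<And>x. b \<le> x \<Longrightarrow> 1 - \<delta> < cdf_of \<rho> x" by (auto simp: eventually_at_top_linorder)
  show thesis
  proof (rule that[of c "\<bar>a\<bar> + \<bar>b\<bar>"])
    show "(c has_real_derivative deriv (\<lambda>s. u s x) 0) (at x)" for x
      using flux[of x] by (simp add: u0 c_def[abs_def])
    show "c x = 0" if "\<bar>a\<bar> + \<bar>b\<bar> < \<bar>x\<bar>" for x
    proof -
      have "x \<le> a \<or> b \<le> x" using that by linarith
      then show ?thesis using v0[OF cdf_in[of x]] a b by (auto simp: c_def)
    qed
    show "continuous_on UNIV (\<lambda>x. deriv (\<lambda>s. u s x) 0)"
      by (rule smooth_density_curve_deriv[OF u J])
  next
    fix m g
    define D where "D = lorenz_metric_density m (lorenz \<rho>) g \<eta>"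
    assume "interval_lebesgue_integrable lborel 0 1
        (lorenz_metric_density m (lorenz \<rho>) g (\<lambda>f. deriv (\<lambda>s. lorenz (u s) f) 0))"
    then have "interval_lebesgue_integrable lborel 0 1 D" by (simp add: D_def \<eta>_def[abs_def])
    moreover have e01: "einterval 0 1 = {0<..<1}" by (auto simp: einterval_iff)
    ultimately have D: "set_integrable lborel {0<..<1} D" by (simp add: interval_lebesgue_integrable_def)
    have metric: "lorenz_metric m (lorenz \<rho>) g \<eta> = integral {0<..<1} D"
      using set_borel_integral_eq_integral(2)[OF D]
      by (simp add: lorenz_metric_def interval_lebesgue_integral_def e01 D_def)
    have "set_integrable lebesgue {0<..<1} D"
      using D by (simp add: set_integrable_def integrable_completion)
    \<comment> \<open>Substitution in this form asks of \<open>D\<close> only absolute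
      integrability, and of the cdf differentiability and injectivity; nothing is known about
      continuity of \<open>deriv g\<close>.\<close>
    then have "D absolutely_integrable_on (range (cdf_of \<rho>)) \<and> integral (range (cdf_of \<rho>)) D = integral {0<..<1} D"
      by (simp add: range_cdf)
    then have *: "(\<lambda>x. \<bar>\<rho> x\<bar> * D (cdf_of \<rho> x)) absolutely_integrable_on UNIV \<and>
        integral UNIV (\<lambda>x. \<bar>\<rho> x\<bar> * D (cdf_of \<rho> x)) = integral {0<..<1} D"
      by (subst has_absolute_integral_change_of_variables_1'[where g = "cdf_of \<rho>" and g' = \<rho>])
        (use DERIV_cdf inj_cdf in auto)
    \<comment> \<open>The Jacobian \<open>\<rho> x\<close> joins the slope \<open>v\<close> of the
      velocity to form \<open>- c x\<close>.\<close>
    have "\<bar>\<rho> x\<bar> * D (cdf_of \<rho> x) = - (deriv g (cdf_of \<rho> x) / m (\<rho> x) * c x)" for x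
      using pos[of x] cdf_in[of x]
      by (simp add: D_def eta[OF cdf_in] deriv2_lorenz[OF cdf_in] c_def divide_inverse)
    with * have i: "(\<lambda>x. - (deriv g (cdf_of \<rho> x) / m (\<rho> x) * c x)) absolutely_integrable_on UNIV"
      "integral UNIV (\<lambda>x. - (deriv g (cdf_of \<rho> x) / m (\<rho> x) * c x)) = integral {0<..<1} D"
      by simp_all
    from set_integrable_mult_right[OF i(1), of "-1"] i(2) metric
    show "(\<lambda>x. deriv g (cdf_of \<rho> x) / m (\<rho> x) * c x) absolutely_integrable_on UNIV \<and>
      lorenz_metric m (lorenz \<rho>) g (\<lambda>f. deriv (\<lambda>s. lorenz (u s) f) 0)
        = - integral UNIV (\<lambda>x. deriv g (cdf_of \<rho> x) / m (\<rho> x) * c x)"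
      by (simp add: \<eta>_def[abs_def])
  qed
qed

section \<open>Test functions\<close>

text \<open>The classical flat function is the case \<open>j = 0\<close>. Differentiation produces
  further powers in the denominator; including them keeps derivatives in the span of the
  family.\<close>

definition flat_exp :: "nat \<Rightarrow> real \<Rightarrow> real" where
  "flat_exp j x = (if 0 < x then exp (- 1 / x) / x ^ j else 0)"

text \<open>With \<open>1 / x\<close> as variable, the exponential beats every power.\<close>

lemma flat_exp_tendsto_0: "(flat_exp j \<longlongrightarrow> 0) (at 0)"
proof -
  have "((\<lambda>x::real. x ^ j / exp x) \<longlongrightarrow> 0) at_top" by (rule tendsto_power_div_exp_0)
  then have "((\<lambda>x::real. (inverse x) ^ j / exp (inverse x)) \<longlongrightarrow> 0) (at_right 0)"
    by (rule filterlim_compose[OF _ filterlim_inverse_at_top_right])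
  moreover have "\<forall>\<^sub>F x in at_right 0. (inverse x) ^ j / exp (inverse x) = flat_exp j x"
    using eventually_at_right_less[of 0]
    by eventually_elim (simp add: flat_exp_def exp_minus divide_simps)
  ultimately have "(flat_exp j \<longlongrightarrow> 0) (at_right 0)" by (rule Lim_transform_eventually)
  moreover have "(flat_exp j \<longlongrightarrow> 0) (at_left 0)"
  proof (rule tendsto_eventually)
    show "\<forall>\<^sub>F x in at_left 0. flat_exp j x = 0"
      by (auto simp: eventually_at_filter flat_exp_def)
  qed
  ultimately show ?thesis by (simp add: filterlim_split_at)
qed

lemma DERIV_flat_exp:
  "(flat_exp j has_real_derivative flat_exp (j + 2) x - real j * flat_exp (j + 1) x) (at x)"
proof -
  consider "x > 0" | "x < 0" | "x = 0" by linarith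
  then show ?thesis
  proof cases
    case 1
    have inv: "((\<lambda>x. - 1 / x) has_real_derivative 1 / x\<^sup>2) (at x)"
      by (rule DERIV_cong[OF DERIV_divide[OF DERIV_const DERIV_ident]])
        (use 1 in \<open>auto simp: power2_eq_square\<close>)
    have "((\<lambda>x. exp (- 1 / x) / x ^ j) has_real_derivative
        (exp (- 1 / x) * (1 / x\<^sup>2) * x ^ j - exp (- 1 / x) * (real j * x ^ (j - Suc 0))) / (x ^ j * x ^ j)) (at x)"
      using 1 by (intro DERIV_divide DERIV_fun_exp inv DERIV_pow) simp
    moreover have "(e * (1 / x\<^sup>2) * x ^ j - e * (real j * x ^ (j - Suc 0))) / (x ^ j * x ^ j)
        = e / x ^ (j + 2) - real j * (e / x ^ (j + 1))" for e
      using 1 by (cases j) (simp_all add: divide_simps power2_eq_square algebra_simps)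
    ultimately have "((\<lambda>x. exp (- 1 / x) / x ^ j) has_real_derivative
        flat_exp (j + 2) x - real j * flat_exp (j + 1) x) (at x)"
      using 1 by (simp only: flat_exp_def if_True)
    then show ?thesis
      by (rule has_field_derivative_transform_within_open[where S = "{0<..}"])
        (use 1 in \<open>simp_all add: flat_exp_def\<close>)
  next
    case 2
    have "(flat_exp j has_real_derivative 0) (at x)"
      by (rule has_field_derivative_transform_within_open[OF DERIV_const, where S = "{..<0}"])
        (use 2 in \<open>auto simp: flat_exp_def\<close>)
    then show ?thesis using 2 by (simp add: flat_exp_def)
  next
    case 3
    \<comment> \<open>The difference quotient at \<open>0\<close> is the next member of the family,
      \<open>flat_exp (j + 1)\<close>.\<close>
    have "((\<lambda>h. (flat_exp j h - flat_exp j 0) / (h - 0)) \<longlongrightarrow> 0) (at 0)"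
    proof (rule Lim_transform_eventually[OF flat_exp_tendsto_0[of "j + 1"]])
      show "\<forall>\<^sub>F h in at 0. flat_exp (j + 1) h = (flat_exp j h - flat_exp j 0) / (h - 0)"
        by (auto simp: eventually_at_filter flat_exp_def intro!: always_eventually)
    qed
    then have "(flat_exp j has_real_derivative 0) (at 0)"
      by (simp add: has_field_derivative_iff)
    then show ?thesis using 3 by (simp add: flat_exp_def)
  qed
qed

lemma smooth_on_flat_exp: "smooth_on UNIV (flat_exp j)"
proof -
  have "ck k UNIV (flat_exp j)" for k
  proof (induction k arbitrary: j)
    case 0
    show ?case
      using DERIV_isCont[OF DERIV_flat_exp] by (simp add: continuous_at_imp_continuous_on)
  next
    case (Suc k)
    show ?case
    proof (rule ck_SucI)
      show "(flat_exp j has_derivative (\<lambda>v. (flat_exp (j + 2) x - real j * flat_exp (j + 1) x) * v)) (at x)" for x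
        using DERIV_flat_exp unfolding has_field_derivative_def .
      show "ck k UNIV (\<lambda>x. (flat_exp (j + 2) x - real j * flat_exp (j + 1) x) * v)" for v
        by (intro ck_mult ck_diff ck_const open_UNIV Suc)
    qed simp
  qed
  then show ?thesis by (simp add: smooth_on_def)
qed

text \<open>For positive \<open>n\<close> a bump on \<open>{a<..<b}\<close>; larger \<open>n\<close>
  makes its flanks steeper, so that the bumps approximate the indicator of the interval.\<close>

definition test_fun :: "real \<Rightarrow> real \<Rightarrow> real \<Rightarrow> real \<Rightarrow> real" where
  "test_fun n a b x = flat_exp 0 (n * (x - a)) * flat_exp 0 (n * (b - x))"

lemma smooth_on_test_fun: "smooth_on UNIV (test_fun n a b)"
proof -
  have aff: "ck k UNIV (\<lambda>x. n * (x - a))" "ck k UNIV (\<lambda>x. n * (b - x))" for k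
    by (intro ck_mult ck_diff ck_const open_UNIV ck_linear[OF _ bounded_linear_ident])+
  have e: "ck k UNIV (flat_exp 0)" for k
    using smooth_on_flat_exp by (simp add: smooth_on_def)
  have "ck k UNIV (\<lambda>x. flat_exp 0 (n * (x - a)) * flat_exp 0 (n * (b - x)))" for k
    by (rule ck_mult[OF open_UNIV ck_compose[OF open_UNIV open_UNIV subset_UNIV e aff(1)]
          ck_compose[OF open_UNIV open_UNIV subset_UNIV e aff(2)]])
  then show ?thesis by (simp add: smooth_on_def test_fun_def[abs_def])
qed

lemma flat_exp_0_le_1: "0 \<le> flat_exp 0 x" "flat_exp 0 x \<le> 1"
  by (auto simp: flat_exp_def)

lemma test_fun_bounds: "0 \<le> test_fun n a b x" "test_fun n a b x \<le> 1"
  using flat_exp_0_le_1 by (auto simp: test_fun_def intro!: mult_le_one)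

lemma test_fun_outside: "n > 0 \<Longrightarrow> x \<notin> {a<..<b} \<Longrightarrow> test_fun n a b x = 0"
  by (auto simp: test_fun_def flat_exp_def zero_less_mult_iff)

lemma test_fun_pos: "n > 0 \<Longrightarrow> x \<in> {a<..<b} \<Longrightarrow> test_fun n a b x > 0"
  by (auto simp: test_fun_def flat_exp_def)

lemma test_fun_tendsto_indicator:
  "(\<lambda>n. test_fun (real (Suc n)) a b x) \<longlonglongrightarrow> indicator {a<..<b} x"
proof (cases "x \<in> {a<..<b}")
  case True
  have "(\<lambda>n. exp (- (1 / d) * inverse (real (Suc n)))) \<longlonglongrightarrow> exp (- (1 / d) * 0)" for d :: real
    by (intro tendsto_exp tendsto_mult tendsto_const LIMSEQ_inverse_real_of_nat)
  from tendsto_mult[OF this[of "x - a"] this[of "b - x"]]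
  have "(\<lambda>n. exp (- (1 / (x - a)) * inverse (real (Suc n))) * exp (- (1 / (b - x)) * inverse (real (Suc n)))) \<longlonglongrightarrow> 1"
    by simp
  moreover have "exp (- (1 / (x - a)) * inverse (real (Suc n))) * exp (- (1 / (b - x)) * inverse (real (Suc n)))
      = test_fun (real (Suc n)) a b x" for n
    using True by (simp add: test_fun_def flat_exp_def divide_inverse mult.commute zero_less_mult_iff del: of_nat_Suc)
  ultimately show ?thesis using True by simp
qed (simp add: test_fun_outside del: of_nat_Suc)

lemma continuous_positive_lower_bound:
  fixes \<sigma> \<theta> :: "real \<Rightarrow> real"
  assumes "continuous_on UNIV \<sigma>" "\<And>x. 0 < \<sigma> x" "continuous_on UNIV \<theta>" "\<And>x. r < \<bar>x\<bar> \<Longrightarrow> \<theta> x = 0"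
  shows "\<exists>\<epsilon>>0. \<forall>s\<in>{-\<epsilon><..<\<epsilon>}. \<forall>x. 0 < \<sigma> x + s * \<theta> x"
proof -
  define S where "S = {-\<bar>r\<bar>..\<bar>r\<bar>}"
  have S: "compact S" "S \<noteq> {}" by (auto simp: S_def)
  have "continuous_on S (\<lambda>x. \<bar>\<theta> x\<bar> / \<sigma> x)"
    using assms(2) by (intro continuous_intros continuous_on_subset[OF assms(1)] continuous_on_subset[OF assms(3)])
      (auto simp: less_le dest: sym)
  then obtain x0 where x0: "\<And>x. x \<in> S \<Longrightarrow> \<bar>\<theta> x\<bar> / \<sigma> x \<le> \<bar>\<theta> x0\<bar> / \<sigma> x0"
    using continuous_attains_sup[OF S] by blast
  \<comment> \<open>The maximum of \<open>\<bar>\<theta> x\<bar> / \<sigma> x\<close> on an interval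
    outside of which \<open>\<theta>\<close> vanishes, plus one to be positive and strictly
    larger.\<close>
  define K where "K = \<bar>\<theta> x0\<bar> / \<sigma> x0 + 1"
  have K: "K > 0" using assms(2)[of x0] by (simp add: K_def add_nonneg_pos)
  show ?thesis
  proof (intro exI[of _ "1 / K"] conjI ballI allI)
    show "1 / K > 0" using K by simp
    fix s x :: real assume s: "s \<in> {-(1 / K)<..<1 / K}"
    show "0 < \<sigma> x + s * \<theta> x"
    proof (cases "x \<in> S")
      case True
      then have "\<bar>\<theta> x\<bar> / \<sigma> x < K" using x0[of x] by (simp add: K_def)
      then have le: "\<bar>\<theta> x\<bar> < K * \<sigma> x" using assms(2)[of x] by (simp add: field_simps)
      have "\<bar>s * \<theta> x\<bar> \<le> 1 / K * \<bar>\<theta> x\<bar>" unfolding abs_mult using s by (intro mult_right_mono) auto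
      also have "\<dots> < \<sigma> x" using le K by (simp add: field_simps)
      finally show ?thesis by linarith
    next
      case False
      then have "r < \<bar>x\<bar>" by (auto simp: S_def)
      then show ?thesis using assms(2,4) by simp
    qed
  qed
qed

text \<open>Perturbing by the derivative of \<open>\<psi>\<close> conserves the mass, and the
  compactly supported antiderivative of the velocity is \<open>\<psi>\<close> itself; so an
  arbitrary test function can take the place of the flux \<open>c\<close>.\<close>

lemma density_variation_of_test_fun:
  fixes \<psi> :: "real \<Rightarrow> real"
  assumes \<rho>: "smooth_density_curve I \<rho>" and I: "open I" and t: "t \<in> I"
    and psi: "smooth_on UNIV \<psi>" and supp: "\<And>x. r < \<bar>x\<bar> \<Longrightarrow> \<psi> x = 0"
  shows "density_variation (\<rho> t) (\<lambda>s x. \<rho> t x + s * deriv \<psi> x)"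
proof -
  interpret continuous_density "\<rho> t" by (rule smooth_density_curve_continuous_density[OF \<rho> I t])
  note Dpsi = smooth_on_DERIV_deriv[OF psi UNIV_I]
  have "deriv \<psi> x = frechet_derivative \<psi> (at x) 1" for x
    using frechet_derivative_at[OF Dpsi[unfolded has_field_derivative_def]] by (metis mult.right_neutral)
  then have "deriv \<psi> = (\<lambda>x. frechet_derivative \<psi> (at x) 1)" by (rule ext)
  then have chi: "smooth_on UNIV (deriv \<psi>)"
    using smooth_on_partial[OF psi, of 1] by (simp only:)
  have chi_cont: "continuous_on UNIV (deriv \<psi>)" by (rule smooth_on_continuous[OF chi])
  have chi0: "deriv \<psi> x = 0" if "r < \<bar>x\<bar>" for x
    by (rule DERIV_compactly_supported[OF Dpsi supp that])
  obtain \<epsilon> where eps: "\<epsilon> > 0" and upos: "\<And>s x. s \<in> {-\<epsilon><..<\<epsilon>} \<Longrightarrow> 0 < \<rho> t x + s * deriv \<psi> x"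
    using continuous_positive_lower_bound[OF cont pos chi_cont chi0] by blast
  have int0: "integrable lborel (deriv \<psi>)" "integrable lborel (\<lambda>x. x\<^sup>2 * deriv \<psi> x)"
    by (rule compactly_supported_integrable[of _ r]; auto intro!: continuous_intros chi_cont simp: chi0)+
  have "(LINT x|lborel. 1 * deriv \<psi> x) = - integral UNIV (\<lambda>x. 0 * \<psi> x)"
    by (rule integration_by_parts_compact_support[OF _ _ Dpsi chi_cont supp]) auto
  then have total0: "(LINT x|lborel. deriv \<psi> x) = 0" by simp
  have dens: "(\<lambda>x. \<rho> t x + s * deriv \<psi> x) \<in> pos_densities2" if s: "s \<in> {-\<epsilon><..<\<epsilon>}" for s
  proof -
    have "(\<lambda>x. x\<^sup>2 * (\<rho> t x + s * deriv \<psi> x)) = (\<lambda>x. x\<^sup>2 * \<rho> t x + s * (x\<^sup>2 * deriv \<psi> x))"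
      by (simp add: algebra_simps)
    then show ?thesis
      using upos[OF s] integrable int0 second_moment total total0
      by (simp add: pos_densities2_def pos_densities_def)
  qed
  have UU: "open ({-\<epsilon><..<\<epsilon>} \<times> (UNIV :: real set))" and UI: "open (I \<times> (UNIV :: real set))"
    using I by (auto intro: open_Times)
  have "smooth_on ({-\<epsilon><..<\<epsilon>} \<times> UNIV) (\<lambda>z. (\<lambda>(t, x). \<rho> t x) (t, snd z) + fst z * deriv \<psi> (snd z))"
    unfolding smooth_on_def
  proof
    fix k
    have "ck k ({-\<epsilon><..<\<epsilon>} \<times> UNIV) (\<lambda>z. (\<lambda>(t, x). \<rho> t x) (t, snd z))"
    proof (rule ck_compose[OF UU UI])
      show "ck k (I \<times> UNIV) (\<lambda>(t, x). \<rho> t x)" using \<rho> by (simp add: smooth_density_curve_def smooth_on_def)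
      show "ck k ({-\<epsilon><..<\<epsilon>} \<times> UNIV) (\<lambda>z. (t, snd z :: real))"
        by (rule ck_Pair[OF UU ck_const[OF UU] ck_linear[OF UU bounded_linear_snd]])
    qed (use t in auto)
    moreover have "ck k ({-\<epsilon><..<\<epsilon>} \<times> UNIV) (\<lambda>z. deriv \<psi> (snd z))"
      by (rule ck_compose[OF UU open_UNIV _ _ ck_linear[OF UU bounded_linear_snd]])
        (use chi in \<open>auto simp: smooth_on_def\<close>)
    ultimately show "ck k ({-\<epsilon><..<\<epsilon>} \<times> UNIV) (\<lambda>z. (\<lambda>(t, x). \<rho> t x) (t, snd z) + fst z * deriv \<psi> (snd z))"
      by (intro ck_add ck_mult UU ck_linear[OF UU bounded_linear_fst])
  qed
  then have "smooth_density_curve {-\<epsilon><..<\<epsilon>} (\<lambda>s x. \<rho> t x + s * deriv \<psi> x)"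
    using dens by (simp add: smooth_density_curve_def case_prod_beta')
  then show ?thesis
    unfolding density_variation_def using eps chi0 by auto
qed

text \<open>A priori \<open>w\<close> is integrable only after multiplication by a test function.
  Dividing by a bump that is positive on a compact interval gives local integrability; the bumps
  then tend to indicators, so integrals over intervals vanish, and Lebesgue's differentiation
  theorem concludes.\<close>

lemma fundamental_lemma_test_fun:
  fixes w :: "real \<Rightarrow> real"
  assumes int: "\<And>n a b. 0 < n \<Longrightarrow> a < b \<Longrightarrow> (\<lambda>x. w x * test_fun n a b x) absolutely_integrable_on UNIV"
    and zero: "\<And>n a b. 0 < n \<Longrightarrow> a < b \<Longrightarrow> integral UNIV (\<lambda>x. w x * test_fun n a b x) = 0"
  obtains N where "negligible N" "\<And>x. x \<notin> N \<Longrightarrow> w x = 0"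
proof -
  have abs_int: "w absolutely_integrable_on {a..b}" for a b
  proof (cases "a \<le> b")
    case True
    \<comment> \<open>Widened by one on each side, the bump is still positive at \<open>a\<close>
      and \<open>b\<close>, hence its inverse is bounded on \<open>{a..b}\<close>.\<close>
    let ?\<psi> = "test_fun 1 (a - 1) (b + 1)"
    have pos: "?\<psi> x > 0" if "x \<in> {a..b}" for x using that by (intro test_fun_pos) auto
    have cont: "continuous_on {a..b} (\<lambda>x. inverse (?\<psi> x))"
      by (intro continuous_on_inverse continuous_on_subset[OF smooth_on_continuous[OF smooth_on_test_fun]])
        (use pos in fastforce)+
    have "(\<lambda>x. w x * ?\<psi> x) absolutely_integrable_on {a..b}"
      by (rule set_integrable_subset[OF int]) (use True in auto)
    moreover have "(\<lambda>x. inverse (?\<psi> x)) \<in> borel_measurable (lebesgue_on {a..b})"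
      by (rule continuous_imp_measurable_on_sets_lebesgue[OF cont]) simp
    moreover have "bounded ((\<lambda>x. inverse (?\<psi> x)) ` {a..b})"
      by (intro compact_imp_bounded compact_continuous_image cont) simp
    ultimately have "(\<lambda>x. inverse (?\<psi> x) * (w x * ?\<psi> x)) absolutely_integrable_on {a..b}"
      by (intro absolutely_integrable_bounded_measurable_product_real[of "\<lambda>x. inverse (?\<psi> x)"]) simp_all
    then show ?thesis
    proof (rule set_integrable_cong[THEN iffD1, rotated -1])
      show "inverse (?\<psi> x) * (w x * ?\<psi> x) = w x" if "x \<in> {a..b}" for x
        using pos[OF that] by simp
    qed auto
  qed simp
  have integral_0: "integral {a..b} w = 0" if "a < b" for a b
  proof -
    have bound: "(\<lambda>x. if x \<in> {a..b} then \<bar>w x\<bar> else 0) integrable_on UNIV"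
      unfolding integrable_restrict_UNIV using abs_int[of a b] by (simp add: absolutely_integrable_on_def)
    have "(\<lambda>n. integral UNIV (\<lambda>x. w x * test_fun (real (Suc n)) a b x)) \<longlonglongrightarrow>
        integral UNIV (\<lambda>x. w x * indicator {a<..<b} x)"
    proof (rule dominated_convergence(2)[OF _ bound])
      show "(\<lambda>x. w x * test_fun (real (Suc k)) a b x) integrable_on UNIV" for k
        using int[of "real (Suc k)" a b] that by (simp add: absolutely_integrable_on_def)
      show "norm (w x * test_fun (real (Suc k)) a b x) \<le> (if x \<in> {a..b} then \<bar>w x\<bar> else 0)" for k x
        using test_fun_outside[of "real (Suc k)" x a b] test_fun_bounds[of "real (Suc k)" a b x]
        by (cases "x \<in> {a<..<b}") (auto simp: abs_mult mult_left_le simp del: of_nat_Suc)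
      show "(\<lambda>k. w x * test_fun (real (Suc k)) a b x) \<longlonglongrightarrow> w x * indicator {a<..<b} x" for x
        by (intro tendsto_mult tendsto_const test_fun_tendsto_indicator)
    qed
    moreover have "integral UNIV (\<lambda>x. w x * test_fun (real (Suc n)) a b x) = 0" for n
      using zero[of "real (Suc n)" a b] that by simp
    ultimately have "integral UNIV (\<lambda>x. w x * indicator {a<..<b} x) = 0"
      by (simp add: LIMSEQ_const_iff)
    moreover have "(\<lambda>x. w x * indicator {a<..<b} x) = (\<lambda>x. if x \<in> {a<..<b} then w x else 0)"
      by (simp add: fun_eq_iff indicator_def)
    ultimately have "integral {a<..<b} w = 0" by (simp only: integral_restrict_UNIV)
    then show ?thesis by (simp add: integral_open_interval_real)
  qed
  obtain N where N: "negligible N" and lim: "\<And>x e. x \<notin> N \<Longrightarrow> 0 < e \<Longrightarrow>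
      \<exists>d>0. \<forall>h. 0 < h \<and> h < d \<longrightarrow>
        norm (integral (cbox x (x + h *\<^sub>R One)) w /\<^sub>R h ^ DIM(real) - w x) < e"
  proof (rule integrable_ccontinuous_explicit[of w])
    show "w integrable_on cbox a b" for a b
      using abs_int[of a b] by (simp add: absolutely_integrable_on_def)
  qed blast
  show thesis
  proof (rule that[OF N])
    fix x assume x: "x \<notin> N"
    show "w x = 0"
    proof (rule ccontr)
      assume "w x \<noteq> 0"
      \<comment> \<open>With \<open>\<bar>w x\<bar>\<close> as tolerance, averages equal to zero are
        too far from \<open>w x\<close>.\<close>
      then obtain d where d: "d > 0" "\<And>h. 0 < h \<Longrightarrow> h < d \<Longrightarrow>
          norm (integral (cbox x (x + h *\<^sub>R One)) w /\<^sub>R h ^ DIM(real) - w x) < \<bar>w x\<bar>"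
        using lim[OF x, of "\<bar>w x\<bar>"] by (metis zero_less_abs_iff)
      show False using d(2)[of "d / 2"] integral_0[of x "x + d / 2"] d(1) by simp
    qed
  qed
qed

text \<open>The Kurzweil--Henstock integral makes this true for derivatives that need not be Lebesgue
  integrable.\<close>

lemma DERIV_zero_ae_imp_constant:
  fixes f :: "real \<Rightarrow> real"
  assumes der: "\<And>x. (f has_real_derivative f' x) (at x)"
    and N: "negligible N" and 0: "\<And>x. x \<notin> N \<Longrightarrow> f' x = 0"
  shows "f x = f y"
proof -
  have *: "f b = f a" if "a \<le> b" for a b
  proof -
    have "(f' has_integral f b - f a) {a..b}"
      by (rule fundamental_theorem_of_calculus[OF that])
        (use der in \<open>auto simp: has_real_derivative_iff_has_vector_derivative[symmetric] intro: has_field_derivative_at_within\<close>)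
    moreover have "(f' has_integral 0) {a..b}"
      by (rule has_integral_spike[OF N _ has_integral_0]) (use 0 in auto)
    ultimately have "f b - f a = 0" by (rule has_integral_unique)
    then show ?thesis by simp
  qed
  show ?thesis using *[of x y] *[of y x] by (cases "x \<le> y") auto
qed

section \<open>Comparison of the gradients\<close>

text \<open>As \<open>g\<close> is the velocity, its slope on the open interval is the continuous
  \<open>v\<close>, so \<open>k\<close> has an antiderivative with continuous slope, regular enough
  for the integration by parts that makes it a Frechet derivative.\<close>

lemma lorenz_gradient_imp_W_gradient:
  fixes m M :: "real \<Rightarrow> real"
  assumes m_pos: "\<And>r. 0 < r \<Longrightarrow> 0 < m r" and m_cont: "continuous_on {0<..} m"
    and M_eq: "\<And>r. 0 < r \<Longrightarrow> M r = m r * r"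
    and Ft_lorenz: "\<And>\<sigma>. \<sigma> \<in> pos_densities2 \<Longrightarrow> Ft (lorenz \<sigma>) = F \<sigma>"
    and \<rho>: "smooth_density_curve I \<rho>" and I: "open I" and t: "t \<in> I"
    and L: "smooth_on (I \<times> {0<..<1}) (\<lambda>(t, f). lorenz (\<rho> t) f)"
    and grad: "has_lorenz_gradient m Ft (lorenz (\<rho> t)) g"
    and vel: "\<And>f. f \<in> {0..1} \<Longrightarrow> ((\<lambda>s. lorenz (\<rho> s) f) has_real_derivative g f) (at t)"
  shows "has_W_gradient M F (\<rho> t) (\<lambda>x. deriv (\<lambda>s. \<rho> s x) t)"
proof -
  interpret continuous_density "\<rho> t" by (rule smooth_density_curve_continuous_density[OF \<rho> I t])
  obtain w v where
      w: "\<And>f. f \<in> {0<..<1} \<Longrightarrow> ((\<lambda>s. lorenz (\<rho> s) f) has_real_derivative w f) (at t)"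
      and v: "\<And>f. f \<in> {0<..<1} \<Longrightarrow> (w has_real_derivative v f) (at f)"
      and "\<And>f. f \<in> {0<..<1} \<Longrightarrow> ((\<lambda>s. deriv (lorenz (\<rho> s)) f) has_real_derivative v f) (at t)"
      and v_cont: "continuous_on {0<..<1} v"
      and flux: "\<And>x. ((\<lambda>x. - \<rho> t x * v (cdf_of (\<rho> t) x)) has_real_derivative deriv (\<lambda>s. \<rho> s x) t) (at x)"
    using smooth_lorenz_velocity[OF \<rho> I t L] by blast
  have g_v: "deriv g f = v f" if "f \<in> {0<..<1}" for f
  proof (rule DERIV_imp_deriv, rule has_field_derivative_transform_within_open[OF v[OF that] _ that])
    show "w f = g f" if "f \<in> {0<..<1}" for f
      using DERIV_unique[OF w[OF that] vel] that by simp
  qed simp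
  define k where "k x = deriv g (cdf_of (\<rho> t) x) / m (\<rho> t x)" for x
  have k_eq: "k x = v (cdf_of (\<rho> t) x) / m (\<rho> t x)" for x
    by (simp add: k_def g_v[OF cdf_in])
  have k_cont: "continuous_on UNIV k"
    unfolding k_eq[abs_def]
  proof (intro continuous_on_divide)
    show "continuous_on UNIV (\<lambda>x. v (cdf_of (\<rho> t) x))"
      by (rule continuous_on_compose2[OF v_cont])
        (use isCont_cdf cdf_in in \<open>auto intro: continuous_at_imp_continuous_on\<close>)
    show "continuous_on UNIV (\<lambda>x. m (\<rho> t x))"
      by (rule continuous_on_compose2[OF m_cont cont]) (use pos in auto)
    show "\<forall>x\<in>UNIV. m (\<rho> t x) \<noteq> 0" using m_pos[OF pos] by (metis less_irrefl)
  qed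
  \<comment> \<open>A Frechet derivative matters only up to a constant, so any base point
    serves.\<close>
  define \<phi> where "\<phi> x = (LBINT y=ereal 0..ereal x. k y)" for x
  have phi: "(\<phi> has_real_derivative k x) (at x)" for x
    unfolding \<phi>_def[abs_def] by (rule has_derivative_LBINT_upper[OF k_cont])
  have "has_Frechet_derivative F (\<rho> t) \<phi>"
    unfolding has_Frechet_derivative_def
  proof (intro allI impI conjI)
    fix u assume var: "density_variation (\<rho> t) u"
    obtain c r where c: "\<And>x. (c has_real_derivative deriv (\<lambda>s. u s x) 0) (at x)"
      and supp: "\<And>x. r < \<bar>x\<bar> \<Longrightarrow> c x = 0"
      and u_cont: "continuous_on UNIV (\<lambda>x. deriv (\<lambda>s. u s x) 0)"
      and metric: "\<And>m g. interval_lebesgue_integrable lborel 0 1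
        (lorenz_metric_density m (lorenz (\<rho> t)) g (\<lambda>f. deriv (\<lambda>s. lorenz (u s) f) 0)) \<Longrightarrow>
      (\<lambda>x. deriv g (cdf_of (\<rho> t) x) / m (\<rho> t x) * c x) absolutely_integrable_on UNIV \<and>
      lorenz_metric m (lorenz (\<rho> t)) g (\<lambda>f. deriv (\<lambda>s. lorenz (u s) f) 0)
        = - integral UNIV (\<lambda>x. deriv g (cdf_of (\<rho> t) x) / m (\<rho> t x) * c x)"
      using lorenz_metric_eq_flux_integral[OF var] by blast
    note parts = integration_by_parts_compact_support[OF phi k_cont c u_cont supp]
    show "integrable lborel (\<lambda>x. \<phi> x * deriv (\<lambda>s. u s x) 0)" by (rule parts(1))
    have lvar: "lorenz_variation (lorenz (\<rho> t)) (\<lambda>s. lorenz (u s))"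
      by (rule lorenz_variation_of_density_variation[OF var])
    have "((\<lambda>s. Ft (lorenz (u s))) has_real_derivative
        lorenz_metric m (lorenz (\<rho> t)) g (\<lambda>f. deriv (\<lambda>s. lorenz (u s) f) 0)) (at 0)"
      and "interval_lebesgue_integrable lborel 0 1
        (lorenz_metric_density m (lorenz (\<rho> t)) g (\<lambda>f. deriv (\<lambda>s. lorenz (u s) f) 0))"
      using grad lvar unfolding has_lorenz_gradient_def by blast+
    with metric parts(3) have D: "((\<lambda>s. Ft (lorenz (u s))) has_real_derivative
        (LINT x|lborel. \<phi> x * deriv (\<lambda>s. u s x) 0)) (at 0)"
      by (simp add: k_def)
    from var obtain \<epsilon> where eps: "\<epsilon> > 0" and dens: "\<And>s. s \<in> {-\<epsilon><..<\<epsilon>} \<Longrightarrow> u s \<in> pos_densities2"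
      unfolding density_variation_def smooth_density_curve_def by blast
    \<comment> \<open>\<open>Ft\<close> and \<open>F\<close> correspond on
      \<open>pos_densities2\<close> only, so they are exchanged just for times \<open>s\<close> near
      \<open>0\<close> at which \<open>u s\<close> belongs to it.\<close>
    show "((\<lambda>s. F (u s)) has_real_derivative (LINT x|lborel. \<phi> x * deriv (\<lambda>s. u s x) 0)) (at 0)"
      by (rule has_field_derivative_transform_within_open[OF D, of "{-\<epsilon><..<\<epsilon>}"])
        (use eps dens Ft_lorenz in auto)
  qed
  moreover have "\<phi> differentiable (at x)" for x
    using phi real_differentiable_def by blast
  moreover have "((\<lambda>y. M (\<rho> t y) * deriv \<phi> y) has_real_derivative - deriv (\<lambda>s. \<rho> s x) t) (at x)" for x
  proof -
    have "(\<lambda>y. M (\<rho> t y) * deriv \<phi> y) = (\<lambda>y. - (- \<rho> t y * v (cdf_of (\<rho> t) y)))"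
    proof
      fix y
      show "M (\<rho> t y) * deriv \<phi> y = - (- \<rho> t y * v (cdf_of (\<rho> t) y))"
        using m_pos[OF pos[of y]] by (simp add: DERIV_imp_deriv[OF phi] M_eq[OF pos] k_eq)
    qed
    then show ?thesis using DERIV_minus[OF flux] by simp
  qed
  ultimately show ?thesis unfolding has_W_gradient_def by blast
qed

text \<open>Differentiating \<open>F\<close> along one test variation, through \<open>\<phi>\<close>
  and through \<open>g\<close>, gives \<open>k x = deriv \<phi> x\<close> for almost every
  \<open>x\<close>. Since \<open>g\<close> is differentiable everywhere in the open interval, this
  suffices to recover it up to a constant, which the value at \<open>0\<close> fixes.\<close>

lemma W_gradient_imp_lorenz_gradient:
  fixes m M :: "real \<Rightarrow> real"
  assumes m_pos: "\<And>r. 0 < r \<Longrightarrow> 0 < m r" and m_cont: "continuous_on {0<..} m"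
    and M_eq: "\<And>r. 0 < r \<Longrightarrow> M r = m r * r"
    and Ft_lorenz: "\<And>\<sigma>. \<sigma> \<in> pos_densities2 \<Longrightarrow> Ft (lorenz \<sigma>) = F \<sigma>"
    and \<rho>: "smooth_density_curve I \<rho>" and I: "open I" and t: "t \<in> I"
    and L: "smooth_on (I \<times> {0<..<1}) (\<lambda>(t, f). lorenz (\<rho> t) f)"
    and eta: "\<eta> \<in> lorenz_tangent_space"
      "\<And>f. f \<in> {0..1} \<Longrightarrow> ((\<lambda>s. lorenz (\<rho> s) f) has_real_derivative \<eta> f) (at t)"
    and grad: "has_lorenz_gradient m Ft (lorenz (\<rho> t)) g"
    and Wgrad: "has_W_gradient M F (\<rho> t) (\<lambda>x. deriv (\<lambda>s. \<rho> s x) t)"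
    and f: "f \<in> {0..1}"
  shows "g f = \<eta> f"
proof -
  interpret continuous_density "\<rho> t" by (rule smooth_density_curve_continuous_density[OF \<rho> I t])
  obtain w v where
      w: "\<And>f. f \<in> {0<..<1} \<Longrightarrow> ((\<lambda>s. lorenz (\<rho> s) f) has_real_derivative w f) (at t)"
      and v: "\<And>f. f \<in> {0<..<1} \<Longrightarrow> (w has_real_derivative v f) (at f)"
      and "\<And>f. f \<in> {0<..<1} \<Longrightarrow> ((\<lambda>s. deriv (lorenz (\<rho> s)) f) has_real_derivative v f) (at t)"
      and "continuous_on {0<..<1} v"
      and flux: "\<And>x. ((\<lambda>x. - \<rho> t x * v (cdf_of (\<rho> t) x)) has_real_derivative deriv (\<lambda>s. \<rho> s x) t) (at x)"
    using smooth_lorenz_velocity[OF \<rho> I t L] by blast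
  have eta_v: "(\<eta> has_real_derivative v f) (at f)" if "f \<in> {0<..<1}" for f
  proof (rule has_field_derivative_transform_within_open[OF v[OF that] _ that])
    show "w f = \<eta> f" if "f \<in> {0<..<1}" for f
      using DERIV_unique[OF w[OF that] eta(2)] that by simp
  qed simp
  have g: "g \<in> lorenz_tangent_space" using grad by (simp add: has_lorenz_gradient_def)
  have g_deriv: "(g has_real_derivative deriv g f) (at f)" if "f \<in> {0<..<1}" for f
  proof -
    have "g differentiable (at f within {0..1})" using g that by (simp add: lorenz_tangent_space_def)
    moreover have "at f within {0..1} = at f" using that by (intro at_within_interior) simp
    ultimately show ?thesis by (simp add: DERIV_deriv_iff_real_differentiable)
  qed
  obtain \<phi> where Fr: "has_Frechet_derivative F (\<rho> t) \<phi>"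
    and phi_diff: "\<And>x. \<phi> differentiable (at x)"
    and Mphi: "\<And>x. ((\<lambda>y. M (\<rho> t y) * deriv \<phi> y) has_real_derivative - deriv (\<lambda>s. \<rho> s x) t) (at x)"
    using Wgrad unfolding has_W_gradient_def by blast
  have phi: "(\<phi> has_real_derivative deriv \<phi> x) (at x)" for x
    using phi_diff by (simp add: DERIV_deriv_iff_real_differentiable)
  have M_pos: "M (\<rho> t x) > 0" for x using M_eq[OF pos] m_pos[OF pos] pos by simp
  \<comment> \<open>\<open>\<phi>\<close> is only given as differentiable. Its slope is continuous
    because the product with \<open>M (\<rho> t y)\<close> is differentiable and that factor is
    continuous and positive; here continuity of \<open>m\<close> is used.\<close>
  have phi_cont: "continuous_on UNIV (deriv \<phi>)"
  proof -
    have "continuous_on UNIV (\<lambda>x. m (\<rho> t x))"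
      by (rule continuous_on_compose2[OF m_cont cont]) (use pos in auto)
    then have "continuous_on UNIV (\<lambda>x. M (\<rho> t x))" by (simp add: M_eq[OF pos] continuous_on_mult cont)
    moreover have "continuous_on UNIV (\<lambda>y. M (\<rho> t y) * deriv \<phi> y)"
      using DERIV_isCont[OF Mphi] by (simp add: continuous_at_imp_continuous_on)
    moreover have "\<forall>x\<in>UNIV. M (\<rho> t x) \<noteq> 0" using M_pos by (metis less_irrefl)
    ultimately have "continuous_on UNIV (\<lambda>y. M (\<rho> t y) * deriv \<phi> y / M (\<rho> t y))"
      by (intro continuous_on_divide)
    moreover have "(\<lambda>y. M (\<rho> t y) * deriv \<phi> y / M (\<rho> t y)) = deriv \<phi>"
    proof
      show "M (\<rho> t y) * deriv \<phi> y / M (\<rho> t y) = deriv \<phi> y" for y using M_pos[of y] by simp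
    qed
    ultimately show ?thesis by (simp only:)
  qed

  \<comment> \<open>\<open>M (\<rho> t x) * deriv \<phi> x\<close> and
    \<open>\<rho> t x * v (cdf_of (\<rho> t) x)\<close> have the same derivative in
    \<open>x\<close>; \<open>a\<close> is their difference, read off at \<open>0\<close>.\<close>
  define a where "a = M (\<rho> t 0) * deriv \<phi> 0 - \<rho> t 0 * v (cdf_of (\<rho> t) 0)"
  have const: "M (\<rho> t x) * deriv \<phi> x = \<rho> t x * v (cdf_of (\<rho> t) x) + a" for x
  proof -
    have "((\<lambda>y. M (\<rho> t y) * deriv \<phi> y + - \<rho> t y * v (cdf_of (\<rho> t) y)) has_real_derivative 0) (at x)" for x
      using DERIV_add[OF Mphi flux] by simp
    from DERIV_isconst_all[of "\<lambda>y. M (\<rho> t y) * deriv \<phi> y + - \<rho> t y * v (cdf_of (\<rho> t) y)" x 0] this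
    show ?thesis by (simp add: a_def)
  qed

  define k where "k x = deriv g (cdf_of (\<rho> t) x) / m (\<rho> t x)" for x
  have test: "(\<lambda>x. (k x - deriv \<phi> x) * test_fun n p q x) absolutely_integrable_on UNIV \<and>
      integral UNIV (\<lambda>x. (k x - deriv \<phi> x) * test_fun n p q x) = 0" if n: "0 < n" for n p q :: real
  proof -
    let ?\<psi> = "test_fun n p q"
    define r where "r = \<bar>p\<bar> + \<bar>q\<bar>"
    have supp: "?\<psi> x = 0" if "r < \<bar>x\<bar>" for x
      using that by (intro test_fun_outside n) (auto simp: r_def)
    define u where "u s x = \<rho> t x + s * deriv ?\<psi> x" for s x
    have var: "density_variation (\<rho> t) u"
      unfolding u_def[abs_def]
      by (rule density_variation_of_test_fun[OF \<rho> I t smooth_on_test_fun supp])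
    have du: "deriv (\<lambda>s. u s x) 0 = deriv ?\<psi> x" for x
      unfolding u_def by (rule DERIV_imp_deriv) (auto intro!: derivative_eq_intros)
    obtain c r' where c: "\<And>x. (c has_real_derivative deriv (\<lambda>s. u s x) 0) (at x)"
      and supp_c: "\<And>x. r' < \<bar>x\<bar> \<Longrightarrow> c x = 0"
      and u_cont: "continuous_on UNIV (\<lambda>x. deriv (\<lambda>s. u s x) 0)"
      and metric: "\<And>m g. interval_lebesgue_integrable lborel 0 1
        (lorenz_metric_density m (lorenz (\<rho> t)) g (\<lambda>f. deriv (\<lambda>s. lorenz (u s) f) 0)) \<Longrightarrow>
      (\<lambda>x. deriv g (cdf_of (\<rho> t) x) / m (\<rho> t x) * c x) absolutely_integrable_on UNIV \<and>
      lorenz_metric m (lorenz (\<rho> t)) g (\<lambda>f. deriv (\<lambda>s. lorenz (u s) f) 0)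
        = - integral UNIV (\<lambda>x. deriv g (cdf_of (\<rho> t) x) / m (\<rho> t x) * c x)"
      using lorenz_metric_eq_flux_integral[OF var] by blast
    \<comment> \<open>Both are antiderivatives of the same function and vanish far out.\<close>
    have "c x = ?\<psi> x" for x
    proof -
      have "((\<lambda>x. c x - ?\<psi> x) has_real_derivative 0) (at x)" for x
        using DERIV_diff[OF c[of x] smooth_on_DERIV_deriv[OF smooth_on_test_fun[of n p q] UNIV_I, of x]]
        by (simp add: du)
      from DERIV_isconst_all[of "\<lambda>x. c x - ?\<psi> x" x "\<bar>r\<bar> + \<bar>r'\<bar> + 1"] this
      show ?thesis using supp supp_c by simp
    qed
    then have c_eq: "c = ?\<psi>" by (rule ext)
    note parts = integration_by_parts_compact_support[OF phi phi_cont c u_cont supp_c]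
    have lvar: "lorenz_variation (lorenz (\<rho> t)) (\<lambda>s. lorenz (u s))"
      by (rule lorenz_variation_of_density_variation[OF var])
    have D: "((\<lambda>s. Ft (lorenz (u s))) has_real_derivative
        lorenz_metric m (lorenz (\<rho> t)) g (\<lambda>f. deriv (\<lambda>s. lorenz (u s) f) 0)) (at 0)"
      and "interval_lebesgue_integrable lborel 0 1
        (lorenz_metric_density m (lorenz (\<rho> t)) g (\<lambda>f. deriv (\<lambda>s. lorenz (u s) f) 0))"
      using grad lvar unfolding has_lorenz_gradient_def by blast+
    with metric have kc: "(\<lambda>x. k x * c x) absolutely_integrable_on UNIV"
      and metric_eq: "lorenz_metric m (lorenz (\<rho> t)) g (\<lambda>f. deriv (\<lambda>s. lorenz (u s) f) 0)
        = - integral UNIV (\<lambda>x. k x * c x)"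
      unfolding k_def by blast+
    from var obtain \<epsilon> where eps: "\<epsilon> > 0" and dens: "\<And>s. s \<in> {-\<epsilon><..<\<epsilon>} \<Longrightarrow> u s \<in> pos_densities2"
      unfolding density_variation_def smooth_density_curve_def by blast
    have "((\<lambda>s. F (u s)) has_real_derivative - integral UNIV (\<lambda>x. k x * c x)) (at 0)"
      by (rule has_field_derivative_transform_within_open[OF D[unfolded metric_eq], of "{-\<epsilon><..<\<epsilon>}"])
        (use eps dens Ft_lorenz in auto)
    moreover have "((\<lambda>s. F (u s)) has_real_derivative
        (LINT x|lborel. \<phi> x * deriv (\<lambda>s. u s x) 0)) (at 0)"
      using Fr var unfolding has_Frechet_derivative_def by blast
    ultimately have "- integral UNIV (\<lambda>x. k x * c x) = (LINT x|lborel. \<phi> x * deriv (\<lambda>s. u s x) 0)"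
      by (rule DERIV_unique)
    then have eq: "integral UNIV (\<lambda>x. k x * c x) = integral UNIV (\<lambda>x. deriv \<phi> x * c x)"
      using parts(3) by simp
    have phic: "(\<lambda>x. deriv \<phi> x * c x) absolutely_integrable_on UNIV"
      using parts(2) by (simp add: set_integrable_def integrable_completion)
    have "integral UNIV (\<lambda>x. k x * c x - deriv \<phi> x * c x) = 0"
      using eq kc phic by (simp add: Henstock_Kurzweil_Integration.integral_diff set_lebesgue_integral_eq_integral)
    then show ?thesis
      using set_integral_diff(1)[OF kc phic] by (simp add: c_eq left_diff_distrib)
  qed
  obtain N where N: "negligible N" and k_phi: "\<And>x. x \<notin> N \<Longrightarrow> k x - deriv \<phi> x = 0"
    by (rule fundamental_lemma_test_fun[of "\<lambda>x. k x - deriv \<phi> x"]) (use test in blast)+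

  \<comment> \<open>Almost everywhere \<open>g (cdf_of (\<rho> t) x)\<close> has derivative
    \<open>M (\<rho> t x) * deriv \<phi> x\<close>, which is the derivative of
    \<open>\<eta> (cdf_of (\<rho> t) x)\<close> plus \<open>a\<close>; the linear term compensates
    for \<open>a\<close>.\<close>
  define z where "z x = g (cdf_of (\<rho> t) x) - \<eta> (cdf_of (\<rho> t) x) - a * x" for x
  have dz: "(z has_real_derivative
      deriv g (cdf_of (\<rho> t) x) * \<rho> t x - v (cdf_of (\<rho> t) x) * \<rho> t x - a) (at x)" for x
    unfolding z_def
    by (intro DERIV_diff DERIV_chain2[OF g_deriv[OF cdf_in] DERIV_cdf]
        DERIV_chain2[OF eta_v[OF cdf_in] DERIV_cdf] DERIV_cmult_Id)
  have z_const: "z x = z 0" for x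
  proof (rule DERIV_zero_ae_imp_constant[OF dz N])
    fix x assume "x \<notin> N"
    then have "deriv g (cdf_of (\<rho> t) x) = m (\<rho> t x) * deriv \<phi> x"
      using k_phi[of x] m_pos[OF pos[of x]] by (simp add: k_def field_simps)
    then show "deriv g (cdf_of (\<rho> t) x) * \<rho> t x - v (cdf_of (\<rho> t) x) * \<rho> t x - a = 0"
      using const[of x] M_eq[OF pos[of x]] by (simp add: algebra_simps)
  qed
  have cont_diff: "continuous_on {0..1} (\<lambda>f. g f - \<eta> f)"
    using g eta(1) by (intro continuous_on_diff)
      (auto simp: lorenz_tangent_space_def continuous_on_eq_continuous_within
        intro: differentiable_imp_continuous_within)
  then have "bounded ((\<lambda>f. g f - \<eta> f) ` {0..1})"
    by (intro compact_imp_bounded compact_continuous_image) auto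
  then obtain K where K: "\<forall>f\<in>{0..1}. \<bar>g f - \<eta> f\<bar> \<le> K"
    unfolding bounded_iff by auto
  \<comment> \<open>The flux is determined up to a constant \<open>a\<close>; since a tangent vector is bounded, \<open>a = 0\<close>.\<close>
  have "a = 0"
  proof (rule ccontr)
    assume a: "a \<noteq> 0"
    \<comment> \<open>Chosen so that \<open>a * x + z 0\<close> is at least
      \<open>K + 1\<close>.\<close>
    define x where "x = (K + \<bar>z 0\<bar> + 1) / a"
    have "a * x + z 0 = g (cdf_of (\<rho> t) x) - \<eta> (cdf_of (\<rho> t) x)"
      using z_const[of x] by (simp add: z_def)
    moreover have "\<bar>g (cdf_of (\<rho> t) x) - \<eta> (cdf_of (\<rho> t) x)\<bar> \<le> K"
      using K cdf_in[of x] by simp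
    moreover have "a * x = K + \<bar>z 0\<bar> + 1" using a by (simp add: x_def)
    ultimately show False by linarith
  qed
  have inner: "g f - \<eta> f = z 0" if "f \<in> {0<..<1}" for f
    using z_const[of "quantile f"] cdf_quantile[OF that] \<open>a = 0\<close> by (simp add: z_def)
  \<comment> \<open>Continuity carries the constant difference to the end point \<open>0\<close>,
    where both tangent vectors vanish.\<close>
  have closed: "g f - \<eta> f = z 0" if "f \<in> {0..1}" for f
    by (rule continuous_constant_on_closure[of "{0<..<1}"]) (use cont_diff inner that in auto)
  have "z 0 = 0" using closed[of 0] g eta(1) by (simp add: lorenz_tangent_space_def)
  then show ?thesis using closed[OF f] by simp
qed

theorem theorem3p9:
  fixes m M :: "real \<Rightarrow> real"
    and F Ft :: "(real \<Rightarrow> real) \<Rightarrow> real"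
    and I :: "real set"
    and \<rho> :: "real \<Rightarrow> real \<Rightarrow> real"
  assumes m_pos: "\<And>r. 0 < r \<Longrightarrow> 0 < m r"
    and m_cont: "continuous_on {0<..} m"
    and M_eq: "\<And>r. 0 < r \<Longrightarrow> M r = m r * r"
    and Ft_lorenz: "\<And>\<sigma>. \<sigma> \<in> pos_densities2 \<Longrightarrow> Ft (lorenz \<sigma>) = F \<sigma>"
    and times: "open I" "is_interval I"
    and density_curve: "smooth_density_curve I \<rho>"
    and lorenz_curve: "smooth_lorenz_curve I (\<lambda>t. lorenz (\<rho> t))"
    and gradient_exists: "\<And>t. t \<in> I \<Longrightarrow> \<exists>g. has_lorenz_gradient m Ft (lorenz (\<rho> t)) g"
  shows "W_gradient_flow M F I \<rho> \<longleftrightarrow> lorenz_gradient_flow m Ft I (\<lambda>t. lorenz (\<rho> t))"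
proof
  note I = times(1)
  have L: "smooth_on (I \<times> {0<..<1}) (\<lambda>(t, f). lorenz (\<rho> t) f)"
    using lorenz_curve by (simp add: smooth_lorenz_curve_def)
  {
    assume flow: "W_gradient_flow M F I \<rho>"
    show "lorenz_gradient_flow m Ft I (\<lambda>t. lorenz (\<rho> t))"
      unfolding lorenz_gradient_flow_def
    proof
      fix t assume t: "t \<in> I"
      \<comment> \<open>The gradient comes from the hypothesis and is then identified with the
        velocity; in the converse direction the flow itself provides it.\<close>
      from gradient_exists[OF t] obtain g where g: "has_lorenz_gradient m Ft (lorenz (\<rho> t)) g" by blast
      from lorenz_curve t obtain \<eta> where eta: "\<eta> \<in> lorenz_tangent_space"
        "\<And>f. f \<in> {0..1} \<Longrightarrow> ((\<lambda>s. lorenz (\<rho> s) f) has_real_derivative \<eta> f) (at t)"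
        unfolding smooth_lorenz_curve_def by blast
      from flow t obtain \<gamma> where gamma: "has_W_gradient M F (\<rho> t) \<gamma>"
        "\<And>x. ((\<lambda>s. \<rho> s x) has_real_derivative \<gamma> x) (at t)"
        unfolding W_gradient_flow_def by blast
      have "\<gamma> = (\<lambda>x. deriv (\<lambda>s. \<rho> s x) t)"
        by (rule ext) (rule DERIV_imp_deriv[OF gamma(2), symmetric])
      then have W: "has_W_gradient M F (\<rho> t) (\<lambda>x. deriv (\<lambda>s. \<rho> s x) t)" using gamma(1) by simp
      \<comment> \<open>Outside \<open>{0..1}\<close> nothing relates the two functions, but the
        flow equation is read on \<open>{0..1}\<close> only.\<close>
      have "g f = \<eta> f" if "f \<in> {0..1}" for f
        by (rule W_gradient_imp_lorenz_gradient[OF m_pos m_cont M_eq Ft_lorenz density_curve I t L eta g W that])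
      then show "\<exists>g. has_lorenz_gradient m Ft (lorenz (\<rho> t)) g \<and>
          (\<forall>f\<in>{0..1}. ((\<lambda>s. lorenz (\<rho> s) f) has_real_derivative g f) (at t))"
        using g eta(2) by (intro exI[of _ g]) simp
    qed
  next
    assume flow: "lorenz_gradient_flow m Ft I (\<lambda>t. lorenz (\<rho> t))"
    show "W_gradient_flow M F I \<rho>"
      unfolding W_gradient_flow_def
    proof
      fix t assume t: "t \<in> I"
      from flow t obtain g where g: "has_lorenz_gradient m Ft (lorenz (\<rho> t)) g"
        "\<And>f. f \<in> {0..1} \<Longrightarrow> ((\<lambda>s. lorenz (\<rho> s) f) has_real_derivative g f) (at t)"
        unfolding lorenz_gradient_flow_def by blast
      have "has_W_gradient M F (\<rho> t) (\<lambda>x. deriv (\<lambda>s. \<rho> s x) t)"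
        by (rule lorenz_gradient_imp_W_gradient[OF m_pos m_cont M_eq Ft_lorenz density_curve I t L g])
      then show "\<exists>\<gamma>. has_W_gradient M F (\<rho> t) \<gamma> \<and>
          (\<forall>x. ((\<lambda>s. \<rho> s x) has_real_derivative \<gamma> x) (at t))"
        using smooth_density_curve_deriv(1)[OF density_curve I t]
        by (intro exI[of _ "\<lambda>x. deriv (\<lambda>s. \<rho> s x) t"]) simp
    qed
  }
qed

end
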